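(* Let $\Omega$ be a measurable space with $\sigma$-algebra $\mathcal{A}$, let $X$ be a real Banach space with dual $X^*$, and let $\Gamma,\Gamma_n:\Omega\to cwk(X)$, $n\in\mathbb{N}$, be scalarly measurable multifunctions. Let $m,m_n$, $n\in\mathbb{N}$, be finite nonnegative measures on $(\Omega,\mathcal{A})$. Suppose that (j) the sequence $(\Gamma_n)_n$ has scalarly uniformly absolutely continuous $(m_n)$-integrals on $\Omega$; (jj) $\Gamma$ is scalarly $m$-integrable; (jjj) $(m_n)_n$ is uniformly absolutely continuous with respect to $m$; (jv) each multifunction $\Gamma_n$ is Pettis $m_n$-integrable (in $cwk(X)$); (v) for every $A\in\mathcal{A}$ and every $x^*\in X^*$, $$\lim_n\int_A s(x^*,\Gamma_n)\,dm_n=\int_A s(x^*,\Gamma)\,dm.$$ Then the multifunction $\Gamma$ is Pettis $m$-integrable (in $cwk(X)$).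
   Context: $cwk(X)$ is the family of all nonempty weakly compact convex subsets of $X$. For $C\in cwk(X)$ and $x^*\in X^*$, the support function is $s(x^*,C)=\sup\{\langle x^*,x\rangle: x\in C\}$. For a multifunction $\Gamma:\Omega\to cwk(X)$, $s(x^*,\Gamma)$ denotes the function $t\mapsto s(x^*,\Gamma(t))$. $\Gamma$ is scalarly measurable (resp. scalarly $m$-integrable) if $s(x^*,\Gamma)$ is $\mathcal{A}$-measurable (resp. $m$-integrable) for every $x^*\in X^*$. $\Gamma$ is Pettis $m$-integrable in $cwk(X)$ if it is scalarly $m$-integrable and for every $A\in\mathcal{A}$ there is a set $M_\Gamma(A)\in cwk(X)$ such that $s(x^*,M_\Gamma(A))=\int_A s(x^*,\Gamma)\,dm$ for all $x^*\in X^*$. A sequence $(\Gamma_n)_n$ of multifunctions with $\Gamma_n$ scalarly $m_n$-integrable for each $n$ has scalarly uniformly absolutely continuous $(m_n)$-integrals on $\Omega$ if for every $\varepsilon>0$ there is $\delta>0$ such that for every $n\in\mathbb{N}$ and $A\in\mathcal{A}$: $m_n(A)<\delta$ implies $\sup\{\int_A|s(x^*,\Gamma_n)|\,dm_n:\|x^*\|\le1\}<\varepsilon$. $(m_n)_n$ is uniformly absolutely continuous with respect to $m$ if for each $\varepsilon>0$ there is $\delta>0$ such that for every $E\in\mathcal{A}$: $m(E)<\delta$ implies $\sup_n m_n(E)<\varepsilon$. *)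

theory Defs
  imports "HOL-Analysis.Analysis"
begin

definition weak_topology :: "'x::real_normed_vector topology" where
  "weak_topology = topology_generated_by
     {blinfun_apply f -` U | (f :: 'x \<Rightarrow>\<^sub>L real) U. open U}"

definition cwk :: "'x::real_normed_vector set set" where
  "cwk = {C. C \<noteq> {} \<and> convex C \<and> compactin weak_topology C}"

text \<open>
  On bounded nonempty sets, in particular on members of \<open>cwk\<close>, the real-valued \<open>Sup\<close> below is
  the genuine supremum.
\<close>

definition support_fun :: "('x::real_normed_vector \<Rightarrow>\<^sub>L real) \<Rightarrow> 'x set \<Rightarrow> real" where
  "support_fun f C = (SUP x\<in>C. blinfun_apply f x)"

definition scalarly_measurable ::
  "'w measure \<Rightarrow> ('w \<Rightarrow> 'x::real_normed_vector set) \<Rightarrow> bool" where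
  "scalarly_measurable M \<Gamma> \<longleftrightarrow>
     (\<forall>f. (\<lambda>t. support_fun f (\<Gamma> t)) \<in> borel_measurable M)"

definition scalarly_integrable ::
  "'w measure \<Rightarrow> ('w \<Rightarrow> 'x::real_normed_vector set) \<Rightarrow> bool" where
  "scalarly_integrable m \<Gamma> \<longleftrightarrow> (\<forall>f. integrable m (\<lambda>t. support_fun f (\<Gamma> t)))"

definition pettis_integrable_cwk ::
  "'w measure \<Rightarrow> ('w \<Rightarrow> 'x::real_normed_vector set) \<Rightarrow> bool" where
  "pettis_integrable_cwk m \<Gamma> \<longleftrightarrow>
     scalarly_integrable m \<Gamma> \<and>
     (\<forall>A\<in>sets m. \<exists>C\<in>cwk. \<forall>f. support_fun f C = (LINT t:A|m. support_fun f (\<Gamma> t)))"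

text \<open>
  The suprema in the next two definitions are taken in \<open>ennreal\<close>, so that an infinite supremum is
  not below \<open>\<epsilon>\<close>.
\<close>

definition scalarly_uniformly_ac_integrals ::
  "(nat \<Rightarrow> 'w measure) \<Rightarrow> (nat \<Rightarrow> 'w \<Rightarrow> 'x::real_normed_vector set) \<Rightarrow> bool" where
  "scalarly_uniformly_ac_integrals m \<Gamma> \<longleftrightarrow>
     (\<forall>n. scalarly_integrable (m n) (\<Gamma> n)) \<and>
     (\<forall>\<epsilon>::real. \<epsilon> > 0 \<longrightarrow> (\<exists>\<delta>::real. \<delta> > 0 \<and>
       (\<forall>n. \<forall>A\<in>sets (m n). emeasure (m n) A < ennreal \<delta> \<longrightarrow>
         (SUP f\<in>{f. norm f \<le> 1}. ennreal (LINT t:A|m n. \<bar>support_fun f (\<Gamma> n t)\<bar>))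
           < ennreal \<epsilon>)))"

definition uniformly_absolutely_continuous ::
  "(nat \<Rightarrow> 'w measure) \<Rightarrow> 'w measure \<Rightarrow> bool" where
  "uniformly_absolutely_continuous mn m \<longleftrightarrow>
     (\<forall>\<epsilon>::real. \<epsilon> > 0 \<longrightarrow> (\<exists>\<delta>::real. \<delta> > 0 \<and>
       (\<forall>E\<in>sets m. emeasure m E < ennreal \<delta> \<longrightarrow> (SUP n. emeasure (mn n) E) < ennreal \<epsilon>)))"

end

theory Submission
  imports Defs "HOL-Library.Function_Algebras"
begin

text \<open>
  Fix a measurable set \<open>A\<close> and let \<open>\<phi> y\<close> be the integral over \<open>A\<close> of the support function of \<open>\<Gamma>\<close> at \<open>y\<close>,
  for \<open>y\<close> in the dual space. The functional \<open>\<phi>\<close> is sublinear, and it is the pointwise limit of the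
  support functions of the weakly compact convex sets \<open>C n\<close> that are the integrals of the given
  multifunctions over \<open>A\<close>. It has to be shown that \<open>\<phi>\<close> is itself the support function of such a set. By
  the theorems of Tychonoff and Hahn-Banach (\<open>cwk_of_sublinear\<close>), this holds as soon as every linear
  functional \<open>\<psi> \<le> \<phi>\<close> on the dual is the evaluation at a point of the space.

  A linear functional below the support function of one weakly compact convex set is the evaluation
  at a point of the set (\<open>dominated_by_support_fun_is_evaluation\<close>), and by the sandwich form of the
  Hahn-Banach theorem this persists for finite sums. So the functionals \<open>q N\<close> that measure the size of
  \<open>y\<close> on the first \<open>N\<close> sets dominate only evaluations. If for each \<open>e > 0\<close> there is an \<open>N\<close> with
  \<open>\<psi> \<le> N * q N + e * norm\<close>, then \<open>\<psi>\<close> is a norm limit of evaluations and, the space being complete, an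
  evaluation. If there is no such \<open>N\<close> for some \<open>e\<close>, there are functionals \<open>z k\<close> in the unit ball that
  tend to zero at every point of every \<open>C n\<close>, although \<open>\<psi> (z k)\<close> stays above a positive constant.

  Such a sequence cannot exist (\<open>no_null_sequence_bounded_below\<close>). By Hahn-Banach on a space of simple
  functions, \<open>\<psi>\<close> disintegrates into linear functionals below the support functions of the single sets
  \<open>\<Gamma> t\<close> (\<open>dominated_functional_has_densities\<close>); as far as the sequence \<open>z k\<close> is concerned, these are
  evaluations at points \<open>\<xi> t\<close> of \<open>\<Gamma> t\<close>, so that \<open>\<psi> (z k)\<close> is the integral of \<open>z k (\<xi> t)\<close>. Suitable convex
  combinations of the \<open>z k\<close> converge at almost every \<open>\<xi> t\<close> of a large set, and a limiting functional \<open>w\<close>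
  vanishes on all the \<open>C n\<close>. Therefore \<open>\<phi> w = \<phi> (- w) = 0\<close>, which forces \<open>w\<close> to be constant on almost
  every \<open>\<Gamma> t\<close>. So the integral of \<open>w (\<xi> t)\<close> is \<open>\<phi> w = 0\<close> up to a small error, but as a limit it is bounded
  below by a positive constant. The errors are controlled by the absolute continuity of the integrals
  of \<open>\<Gamma>\<close>, uniform over the dual unit ball, which \<open>\<Gamma>\<close> inherits from the approximating sequence
  (\<open>limit_has_ac_integral\<close>).
\<close>

section \<open>The Hahn-Banach theorem for linear graphs\<close>

definition sublinear_on :: "'a::real_vector set \<Rightarrow> ('a \<Rightarrow> real) \<Rightarrow> bool" where
  "sublinear_on V p \<longleftrightarrow>
     (\<forall>x\<in>V. \<forall>y\<in>V. p (x + y) \<le> p x + p y) \<and> (\<forall>x\<in>V. \<forall>c\<ge>0. p (c *\<^sub>R x) = c * p x)"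

definition linear_functional_on :: "'a::real_vector set \<Rightarrow> ('a \<Rightarrow> real) \<Rightarrow> bool" where
  "linear_functional_on V g \<longleftrightarrow>
     (\<forall>x\<in>V. \<forall>y\<in>V. g (x + y) = g x + g y) \<and> (\<forall>x\<in>V. \<forall>c. g (c *\<^sub>R x) = c * g x)"

lemma linear_functional_on_UNIV: "linear_functional_on UNIV g \<longleftrightarrow> linear g"
  by (auto simp: linear_functional_on_def linear_iff)

lemma sublinear_on_0:
  assumes "sublinear_on V p" "0 \<in> V"
  shows "p 0 = 0"
  using assms unfolding sublinear_on_def by (metis mult_zero_left order_refl scaleR_zero_left)

text \<open>
  The one-dimensional step of the Hahn-Banach theorem. A partially defined linear functional is
  represented by its graph, a subspace of the product with \<open>\<real>\<close>; being dominated by \<open>p\<close> already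
  makes such a subspace single-valued, so functionality need not be tracked.
\<close>
lemma dominated_graph_extends:
  fixes p :: "'a::real_vector \<Rightarrow> real"
  assumes V: "subspace V" and p: "sublinear_on V p"
    and M: "subspace M" "fst ` M \<subseteq> V" "\<And>x r. (x, r) \<in> M \<Longrightarrow> r \<le> p x"
    and v: "v \<in> V"
  obtains M' where "subspace M'" "M \<subseteq> M'" "fst ` M' \<subseteq> V" "v \<in> fst ` M'"
    "\<And>x r. (x, r) \<in> M' \<Longrightarrow> r \<le> p x"
proof -
  have MV: "x \<in> V" if "(x, r) \<in> M" for x r
    using that M(2) by force
  have add: "p (x + y) \<le> p x + p y" if "x \<in> V" "y \<in> V" for x y
    using p that by (auto simp: sublinear_on_def)
  have scale: "p (c *\<^sub>R x) = c * p x" if "x \<in> V" "c \<ge> 0" for x c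
    using p that by (auto simp: sublinear_on_def)
  let ?L = "(\<lambda>(x, r). r - p (x - v)) ` M"
  have sep: "r - p (x - v) \<le> p (x' + v) - r'" if "(x, r) \<in> M" "(x', r') \<in> M" for x r x' r'
  proof -
    have "(x + x', r + r') \<in> M"
      using subspace_add[OF M(1) that] by simp
    then have "r + r' \<le> p ((x - v) + (x' + v))"
      using M(3) by (simp add: algebra_simps)
    also have "\<dots> \<le> p (x - v) + p (x' + v)"
      using that MV v V by (intro add) (auto intro: subspace_diff subspace_add)
    finally show ?thesis by simp
  qed
  have M0: "(0, 0) \<in> M"
    using subspace_0[OF M(1)] by (simp add: zero_prod_def)
  define a where "a = Sup ?L"
  have bdd: "bdd_above ?L"
    using sep[OF _ M0] by (intro bdd_aboveI[where M="p (0 + v) - 0"]) auto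
  have lower: "r - p (x - v) \<le> a" if "(x, r) \<in> M" for x r
    unfolding a_def using that by (intro cSup_upper[OF _ bdd]) force
  have upper: "a \<le> p (x + v) - r" if "(x, r) \<in> M" for x r
    unfolding a_def using that M0 sep by (intro cSup_least) auto
  \<comment> \<open>The value \<open>a\<close> at \<open>v\<close> lies between the lower and the upper bounds that domination by \<open>p\<close>
    at the points \<open>x - v\<close> and \<open>x + v\<close> imposes; homogeneity of \<open>p\<close> extends this to all multiples.\<close>
  define M' where "M' = {(x + c *\<^sub>R v, r + c * a) | x r c. (x, r) \<in> M}"
  show thesis
  proof
    show "subspace M'"
      unfolding subspace_def
    proof (intro conjI ballI allI)
      show "0 \<in> M'"
        unfolding M'_def zero_prod_def using M0 by (force intro!: exI[of _ 0])
      fix u assume "u \<in> M'"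
      then obtain x r c where u: "u = (x + c *\<^sub>R v, r + c * a)" "(x, r) \<in> M"
        by (auto simp: M'_def)
      show "k *\<^sub>R u \<in> M'" for k
      proof -
        have "k *\<^sub>R u = (k *\<^sub>R x + (k * c) *\<^sub>R v, k * r + (k * c) * a)"
          by (simp add: u algebra_simps)
        then show ?thesis
          unfolding M'_def using subspace_scale[OF M(1) u(2), of k] by auto
      qed
      fix w assume "w \<in> M'"
      then obtain x' r' c' where w: "w = (x' + c' *\<^sub>R v, r' + c' * a)" "(x', r') \<in> M"
        by (auto simp: M'_def)
      have "u + w = ((x + x') + (c + c') *\<^sub>R v, (r + r') + (c + c') * a)"
        by (simp add: u w algebra_simps)
      then show "u + w \<in> M'"
        unfolding M'_def using subspace_add[OF M(1) u(2) w(2)] by auto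
    qed
    show "M \<subseteq> M'"
      unfolding M'_def by (force intro: exI[of _ 0])
    show "fst ` M' \<subseteq> V"
      unfolding M'_def using MV v V by (auto intro!: subspace_add[OF V] subspace_scale[OF V])
    show "v \<in> fst ` M'"
    proof (rule image_eqI)
      have "(0 + 1 *\<^sub>R v, 0 + 1 * a) \<in> M'"
        unfolding M'_def using M0 by blast
      then show "(v, a) \<in> M'" by simp
    qed simp
    fix y s assume "(y, s) \<in> M'"
    then obtain x r c where y: "y = x + c *\<^sub>R v" "s = r + c * a" and xr: "(x, r) \<in> M"
      by (auto simp: M'_def)
    consider "c = 0" | "c > 0" | "c < 0" by linarith
    then show "s \<le> p y"
    proof cases
      case 1
      then show ?thesis using M(3)[OF xr] y by simp
    next
      case 2
      have "(inverse c *\<^sub>R x, inverse c * r) \<in> M"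
        using subspace_scale[OF M(1) xr, of "inverse c"] by simp
      note this_M = this
      have "c * a \<le> c * (p (inverse c *\<^sub>R x + v) - inverse c * r)"
        using 2 upper[OF this_M] by (intro mult_left_mono) auto
      also have "\<dots> = p (c *\<^sub>R (inverse c *\<^sub>R x + v)) - r"
        using 2 MV[OF this_M] v V
        by (subst scale) (auto intro: subspace_add simp: right_diff_distrib)
      finally show ?thesis
        using 2 by (simp add: y algebra_simps)
    next
      case 3
      have "(inverse (-c) *\<^sub>R x, inverse (-c) * r) \<in> M"
        using subspace_scale[OF M(1) xr, of "inverse (-c)"] by simp
      note this_M = this
      have "(-c) * (inverse (-c) * r - p (inverse (-c) *\<^sub>R x - v)) \<le> (-c) * a"
        using 3 lower[OF this_M] by (intro mult_left_mono) auto
      moreover have "(-c) * (inverse (-c) * r - p (inverse (-c) *\<^sub>R x - v))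
          = r - p ((-c) *\<^sub>R (inverse (-c) *\<^sub>R x - v))"
        using 3 MV[OF this_M] v V
        by (subst scale) (auto intro: subspace_diff simp: right_diff_distrib)
      moreover have "(-c) *\<^sub>R (inverse (-c) *\<^sub>R x - v) = x + c *\<^sub>R v"
        using 3 by (simp add: algebra_simps)
      ultimately show ?thesis
        by (simp add: y)
    qed
  qed
qed

text \<open>
  Hahn-Banach with the prescribed values given as a linear relation \<open>G\<close>. In this form one statement
  covers all the uses below: extending from the diagonal gives the sandwich theorem, from
  constants the disintegration of functionals below an integral, and from the pairs of a point with
  a limit an extension of pointwise limits.
\<close>
theorem hahn_banach_graph:
  fixes p :: "'a::real_vector \<Rightarrow> real"
  assumes V: "subspace V" and p: "sublinear_on V p"
    and G: "subspace G" "fst ` G \<subseteq> V" "\<And>x r. (x, r) \<in> G \<Longrightarrow> r \<le> p x"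
  obtains g where "linear_functional_on V g" "\<And>x. x \<in> V \<Longrightarrow> g x \<le> p x"
    "\<And>x r. (x, r) \<in> G \<Longrightarrow> g x = r"
proof -
  define \<G> where "\<G> = {M. subspace M \<and> G \<subseteq> M \<and> fst ` M \<subseteq> V \<and> (\<forall>(x, r)\<in>M. r \<le> p x)}"
  have "\<exists>M\<in>\<G>. \<forall>X\<in>\<G>. M \<subseteq> X \<longrightarrow> X = M"
  proof (rule subset_Zorn_nonempty)
    show "\<G> \<noteq> {}"
      using G by (auto simp: \<G>_def)
    fix \<C> assume C: "\<C> \<noteq> {}" "subset.chain \<G> \<C>"
    then have sub: "\<And>M. M \<in> \<C> \<Longrightarrow> M \<in> \<G>"
      and chain: "\<And>M N. M \<in> \<C> \<Longrightarrow> N \<in> \<C> \<Longrightarrow> M \<subseteq> N \<or> N \<subseteq> M"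
      by (auto simp: subset_chain_def)
    have "subspace (\<Union>\<C>)"
      unfolding subspace_def
    proof (intro conjI ballI allI)
      show "0 \<in> \<Union>\<C>"
        using C(1) sub subspace_0 unfolding \<G>_def by blast
      fix u assume "u \<in> \<Union>\<C>"
      then obtain M where M: "M \<in> \<C>" "u \<in> M" by blast
      show "k *\<^sub>R u \<in> \<Union>\<C>" for k
        using M sub[OF M(1)] subspace_scale unfolding \<G>_def by blast
      fix w assume "w \<in> \<Union>\<C>"
      then obtain N where N: "N \<in> \<C>" "w \<in> N" by blast
      obtain K where "K \<in> \<C>" "u \<in> K" "w \<in> K"
        using chain[OF M(1) N(1)] M N by blast
      then show "u + w \<in> \<Union>\<C>"
        using sub[of K] subspace_add unfolding \<G>_def by blast
    qed
    then show "\<Union>\<C> \<in> \<G>"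
      using sub C(1) unfolding \<G>_def by fast
  qed
  then obtain M where M\<G>: "M \<in> \<G>" and max: "\<And>X. X \<in> \<G> \<Longrightarrow> M \<subseteq> X \<Longrightarrow> X = M"
    by blast
  then have M: "subspace M" "G \<subseteq> M" "fst ` M \<subseteq> V" "\<And>x r. (x, r) \<in> M \<Longrightarrow> r \<le> p x"
    by (auto simp: \<G>_def)
  have dom: "v \<in> fst ` M" if v: "v \<in> V" for v
  proof -
    obtain M' where M': "subspace M'" "M \<subseteq> M'" "fst ` M' \<subseteq> V" "v \<in> fst ` M'"
      "\<And>x r. (x, r) \<in> M' \<Longrightarrow> r \<le> p x"
      using dominated_graph_extends[OF V p M(1,3,4) v] by blast
    then have "M' \<in> \<G>" using M(2) by (auto simp: \<G>_def)
    with max M' show ?thesis by blast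
  qed
  have p0: "p 0 = 0"
    using p subspace_0[OF V] by (rule sublinear_on_0)
  have unique: "r = s" if "(x, r) \<in> M" "(x, s) \<in> M" for x r s
  proof -
    have "(0, r - s) \<in> M" "(0, s - r) \<in> M"
      using subspace_diff[OF M(1) that] subspace_diff[OF M(1) that(2,1)] by auto
    from this[THEN M(4)] show ?thesis
      using p0 by simp
  qed
  define g where "g x = (THE r. (x, r) \<in> M)" for x
  have g_eq: "g x = r" if "(x, r) \<in> M" for x r
    unfolding g_def using that unique by blast
  have g_in: "(x, g x) \<in> M" if "x \<in> V" for x
    using dom[OF that] g_eq by force
  show thesis
  proof
    show "linear_functional_on V g"
      unfolding linear_functional_on_def
    proof (intro conjI ballI allI)
      fix x assume x: "x \<in> V"
      show "g (c *\<^sub>R x) = c * g x" for c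
        using subspace_scale[OF M(1) g_in[OF x], of c] by (intro g_eq) simp
      fix y assume y: "y \<in> V"
      show "g (x + y) = g x + g y"
        using subspace_add[OF M(1) g_in[OF x] g_in[OF y]] by (intro g_eq) simp
    qed
    show "g x \<le> p x" if "x \<in> V" for x
      using g_in[OF that] M(4) by blast
    show "g x = r" if "(x, r) \<in> G" for x r
      using that M(2) g_eq by blast
  qed
qed

text \<open>
  On the product space, \<open>(x, y) \<mapsto> p x + q y\<close> is sublinear and dominates \<open>L\<close> on the diagonal; the two
  partial maps of an extension are the summands.
\<close>
lemma hahn_banach_sandwich:
  fixes L :: "'a::real_vector \<Rightarrow> real"
  assumes p: "sublinear_on UNIV p" and q: "sublinear_on UNIV q"
    and L: "linear L" and le: "\<And>x. L x \<le> p x + q x"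
  obtains L' L'' where "linear L'" "linear L''" "\<And>x. L' x \<le> p x" "\<And>x. L'' x \<le> q x"
    "\<And>x. L x = L' x + L'' x"
proof -
  let ?P = "\<lambda>(x, y). p x + q y"
  let ?G = "range (\<lambda>x. ((x, x), L x))"
  have p0: "p 0 = 0" and q0: "q 0 = 0"
    using sublinear_on_0[OF p] sublinear_on_0[OF q] by simp_all
  have "linear (\<lambda>x. ((x, x), L x))"
    using L by (auto simp: linear_iff)
  then have G: "subspace ?G"
    by (rule linear_subspace_image[OF _ subspace_UNIV])
  have P: "sublinear_on UNIV ?P"
    unfolding sublinear_on_def
  proof (intro conjI ballI allI impI)
    fix z w :: "'a \<times> 'a" and c :: real
    show "?P (z + w) \<le> ?P z + ?P w"
      using p q add_mono[of "p (fst z + fst w)" "p (fst z) + p (fst w)"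
          "q (snd z + snd w)" "q (snd z) + q (snd w)"]
      by (simp add: sublinear_on_def case_prod_beta)
    assume "0 \<le> c"
    then show "?P (c *\<^sub>R z) = c * ?P z"
      using p q by (simp add: sublinear_on_def case_prod_beta distrib_left)
  qed
  obtain g where g: "linear_functional_on UNIV g" "\<And>z. g z \<le> ?P z"
    "\<And>z r. (z, r) \<in> ?G \<Longrightarrow> g z = r"
    using hahn_banach_graph[OF subspace_UNIV P G] le by auto
  have lin: "linear g" using g(1) by (simp add: linear_functional_on_UNIV)
  show thesis
  proof
    show "linear (\<lambda>x. g (x, 0))"
      using linear_add[OF lin, of "(_, 0)" "(_, 0)"] linear_cmul[OF lin, of _ "(_, 0)"]
      by (simp add: linear_iff)
    show "linear (\<lambda>y. g (0, y))"
      using linear_add[OF lin, of "(0, _)" "(0, _)"] linear_cmul[OF lin, of _ "(0, _)"]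
      by (simp add: linear_iff)
    show "g (x, 0) \<le> p x" "g (0, x) \<le> q x" for x
      using g(2)[of "(x, 0)"] g(2)[of "(0, x)"] p0 q0 by auto
    show "L x = g (x, 0) + g (0, x)" for x
      using g(3)[of "(x, x)" "L x"] linear_add[OF lin, of "(x, 0)" "(0, x)"] by simp
  qed
qed

lemma dominated_functional_attaining:
  fixes p :: "'a::real_vector \<Rightarrow> real"
  assumes p: "sublinear_on UNIV p"
  obtains L where "linear L" "\<And>x. L x \<le> p x" "L a = p a"
proof -
  let ?G = "range (\<lambda>c. (c *\<^sub>R a, c * p a))"
  have "linear (\<lambda>c. (c *\<^sub>R a, c * p a))"
    by (auto simp: linear_iff algebra_simps)
  then have G: "subspace ?G"
    by (rule linear_subspace_image[OF _ subspace_UNIV])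
  have p0: "p 0 = 0"
    using sublinear_on_0[OF p] by simp
  have "c * p a \<le> p (c *\<^sub>R a)" for c
  proof (cases "c \<ge> 0")
    case True
    then show ?thesis using p by (simp add: sublinear_on_def)
  next
    case False
    have "p (c *\<^sub>R a + (-c) *\<^sub>R a) \<le> p (c *\<^sub>R a) + p ((-c) *\<^sub>R a)"
      using p unfolding sublinear_on_def by blast
    moreover have "p ((-c) *\<^sub>R a) = (-c) * p a"
      using p False unfolding sublinear_on_def by (simp del: scaleR_minus_left)
    ultimately show ?thesis using p0 by simp
  qed
  then obtain g where g: "linear_functional_on UNIV g" "\<And>z. g z \<le> p z"
    "\<And>z r. (z, r) \<in> ?G \<Longrightarrow> g z = r"
    using hahn_banach_graph[OF subspace_UNIV p G] by (smt (verit) Pair_inject UNIV_I rangeE subset_UNIV)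
  show thesis
  proof
    show "linear g" "\<And>z. g z \<le> p z" using g by (auto simp: linear_functional_on_UNIV)
    show "g a = p a" using g(3)[of a "p a"] by (force intro: range_eqI[of _ _ 1])
  qed
qed

lemma linear_bounded_by_norm:
  fixes L :: "'a::real_normed_vector \<Rightarrow> real"
  assumes "linear L" "\<And>x. L x \<le> norm x"
  obtains y :: "'a \<Rightarrow>\<^sub>L real" where "\<And>x. y x = L x" "norm y \<le> 1"
proof -
  have abs: "\<bar>L x\<bar> \<le> norm x" for x
    using assms(2)[of x] assms(2)[of "-x"] linear_neg[OF assms(1), of x] by simp
  then have "bounded_linear L"
    using assms(1) by (intro bounded_linear_intro[of _ 1]) (auto simp: linear_iff)
  then show thesis
    using abs by (intro that[of "Blinfun L"]) (auto simp: bounded_linear_Blinfun_apply intro!: norm_blinfun_bound)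
qed

lemma sublinear_on_norm: "sublinear_on UNIV (\<lambda>x. norm x)"
  by (auto simp: sublinear_on_def norm_triangle_ineq)

lemma norming_functional:
  fixes a :: "'a::real_normed_vector"
  obtains y :: "'a \<Rightarrow>\<^sub>L real" where "norm y \<le> 1" "y a = norm a"
  using dominated_functional_attaining[OF sublinear_on_norm, of a] linear_bounded_by_norm
  by metis

text \<open>
  A substitute for a weak* cluster point of a sequence in the dual unit ball: wherever the sequence
  converges pointwise, the functional takes the limit as its value.
\<close>
lemma norm_extension_of_pointwise_limits:
  fixes y :: "nat \<Rightarrow> 'a::real_normed_vector \<Rightarrow>\<^sub>L real"
  assumes bd: "\<And>k. norm (y k) \<le> 1"
  obtains z :: "'a \<Rightarrow>\<^sub>L real" where "norm z \<le> 1" "\<And>x c. (\<lambda>k. y k x) \<longlonglongrightarrow> c \<Longrightarrow> z x = c"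
proof -
  let ?G = "{(x, c). (\<lambda>k. y k x) \<longlonglongrightarrow> c}"
  have G: "subspace ?G"
    unfolding subspace_def
    by (auto simp: zero_prod_def blinfun.add_right blinfun.scaleR_right intro!: tendsto_intros)
  have "c \<le> norm x" if "(\<lambda>k. y k x) \<longlonglongrightarrow> c" for x c
  proof (rule LIMSEQ_le_const2[OF that])
    have "y k x \<le> norm x" for k
      using norm_blinfun[of "y k" x] mult_right_mono[OF bd[of k], of "norm x"] by simp
    then show "\<exists>N. \<forall>n\<ge>N. y n x \<le> norm x" by blast
  qed
  then obtain g where g: "linear_functional_on UNIV g" "\<And>z. g z \<le> norm z"
    "\<And>z r. (z, r) \<in> ?G \<Longrightarrow> g z = r"
    using hahn_banach_graph[OF subspace_UNIV sublinear_on_norm G] by auto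
  then obtain z :: "'a \<Rightarrow>\<^sub>L real" where z: "\<And>x. z x = g x" "norm z \<le> 1"
    using linear_bounded_by_norm[OF g(1)[unfolded linear_functional_on_UNIV] g(2)] by blast
  show thesis
    by (rule that[OF z(2)]) (simp add: z(1) g(3))
qed

section \<open>Weakly compact convex sets and their support functions\<close>

lemma topspace_weak_topology [simp]: "topspace weak_topology = (UNIV :: 'x::real_normed_vector set)"
proof -
  have "(UNIV :: 'x set) \<in> {blinfun_apply f -` U | (f :: 'x \<Rightarrow>\<^sub>L real) U. open U}"
    by (auto intro!: exI[of _ 0] exI[of _ UNIV])
  then show ?thesis
    unfolding weak_topology_def topology_generated_by_topspace by blast
qed

lemma continuous_map_weak_functional:
  "continuous_map weak_topology euclideanreal (blinfun_apply (f :: 'x::real_normed_vector \<Rightarrow>\<^sub>L real))"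
proof -
  have "openin weak_topology (blinfun_apply f -` U)" if "open U" for U
    unfolding weak_topology_def using that by (intro topology_generated_by_Basis) blast
  then show ?thesis
    by (auto simp: continuous_map_def vimage_def)
qed

lemma compact_image_cwk:
  fixes y :: "'x::real_normed_vector \<Rightarrow>\<^sub>L real"
  assumes "C \<in> cwk"
  shows "compact (blinfun_apply y ` C)"
  using image_compactin[OF _ continuous_map_weak_functional, of C y] assms by (simp add: cwk_def)

lemma bdd_above_cwk:
  fixes y :: "'x::real_normed_vector \<Rightarrow>\<^sub>L real"
  shows "C \<in> cwk \<Longrightarrow> bdd_above (blinfun_apply y ` C)"
  using compact_image_cwk[of C y] by (simp add: bounded_imp_bdd_above compact_imp_bounded)

lemma support_fun_upper:
  assumes "C \<in> cwk" "x \<in> C"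
  shows "blinfun_apply y x \<le> support_fun y C"
  unfolding support_fun_def using assms by (intro cSUP_upper bdd_above_cwk)

lemma support_fun_least:
  assumes "C \<in> cwk" "\<And>x. x \<in> C \<Longrightarrow> blinfun_apply y x \<le> a"
  shows "support_fun y C \<le> a"
  unfolding support_fun_def using assms by (intro cSUP_least) (auto simp: cwk_def)

lemma cwk_nonempty: "C \<in> cwk \<Longrightarrow> \<exists>x. x \<in> C"
  by (auto simp: cwk_def)

lemma support_fun_lower:
  assumes "C \<in> cwk" "x \<in> C"
  shows "- support_fun (- y) C \<le> blinfun_apply y x"
  using support_fun_upper[OF assms, of "- y"] by (simp add: blinfun.minus_left)

lemma sublinear_on_support_fun:
  assumes C: "C \<in> cwk"
  shows "sublinear_on UNIV (\<lambda>y. support_fun y C)"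
  unfolding sublinear_on_def
proof (intro conjI ballI allI impI)
  fix y z :: "'a \<Rightarrow>\<^sub>L real" and c :: real
  show "support_fun (y + z) C \<le> support_fun y C + support_fun z C"
    using C by (intro support_fun_least) (auto simp: blinfun.add_left intro!: add_mono support_fun_upper)
  assume c: "0 \<le> c"
  have le: "support_fun (r *\<^sub>R w) C \<le> r * support_fun w C" if "r \<ge> 0" for r w
    using C that by (intro support_fun_least)
      (auto simp: blinfun.scaleR_left intro!: mult_left_mono support_fun_upper)
  show "support_fun (c *\<^sub>R y) C = c * support_fun y C"
  proof (cases "c = 0")
    case True
    have "C \<noteq> {}" using C by (simp add: cwk_def)
    with True show ?thesis
      by (simp add: support_fun_def)
  next
    case False
    have "c * support_fun (inverse c *\<^sub>R (c *\<^sub>R y)) C \<le> c * (inverse c * support_fun (c *\<^sub>R y) C)"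
      using c by (intro mult_left_mono le) auto
    then show ?thesis
      using le[OF c, of y] False by (simp flip: mult.assoc)
  qed
qed

lemma support_fun_add: "C \<in> cwk \<Longrightarrow> support_fun (y + z) C \<le> support_fun y C + support_fun z C"
  using sublinear_on_support_fun by (auto simp: sublinear_on_def)

lemma support_fun_scaleR: "C \<in> cwk \<Longrightarrow> c \<ge> 0 \<Longrightarrow> support_fun (c *\<^sub>R y) C = c * support_fun y C"
  using sublinear_on_support_fun[of C] unfolding sublinear_on_def by blast

lemma support_fun_zero: "C \<in> cwk \<Longrightarrow> support_fun 0 C = 0"
  using support_fun_scaleR[of C 0 0] by simp

lemma cwk_singleton_0: "{0} \<in> cwk"
  by (simp add: cwk_def finite_imp_compactin)

text \<open>
  If no linear combination of the equations \<open>y i x = c i\<close> separates the point \<open>c\<close> from \<open>K\<close>, they have a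
  common solution in \<open>K\<close>. The sum of the squared errors attains its minimum on \<open>K\<close>. At a minimiser,
  the errors themselves, used as coefficients, would separate unless they all vanish. This
  replaces separation in a Euclidean space whose dimension is the number of equations.
\<close>
lemma cwk_finite_moments:
  fixes y :: "'i \<Rightarrow> 'x::real_normed_vector \<Rightarrow>\<^sub>L real"
  assumes K: "K \<in> cwk" and F: "finite F"
    and H: "\<And>l. (\<Sum>i\<in>F. l i * c i) \<le> support_fun (\<Sum>i\<in>F. l i *\<^sub>R y i) K"
  shows "\<exists>x\<in>K. \<forall>i\<in>F. y i x = c i"
proof -
  define q where "q x = (\<Sum>i\<in>F. (y i x - c i)\<^sup>2)" for x
  have "continuous_map weak_topology euclideanreal q"
    unfolding q_def using F
    by (intro continuous_map_sum continuous_map_real_pow continuous_map_diff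
        continuous_map_weak_functional) auto
  then have "compact (q ` K)"
    using K image_compactin[of weak_topology K euclideanreal q] by (simp add: cwk_def)
  moreover have "q ` K \<noteq> {}" using K by (simp add: cwk_def)
  ultimately obtain x0 where x0: "x0 \<in> K" and min: "\<And>x. x \<in> K \<Longrightarrow> q x0 \<le> q x"
    using compact_attains_inf[of "q ` K"] by auto
  define l where "l i = c i - y i x0" for i
  \<comment> \<open>First-order optimality of \<open>x0\<close> along the segments from \<open>x0\<close> into \<open>K\<close>.\<close>
  have variational: "(\<Sum>i\<in>F. l i * y i x) \<le> (\<Sum>i\<in>F. l i * y i x0)" if x: "x \<in> K" for x
  proof -
    define d where "d i = y i x - y i x0" for i
    define a where "a = (\<Sum>i\<in>F. l i * d i)"
    define b where "b = (\<Sum>i\<in>F. (d i)\<^sup>2)"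
    have b: "b \<ge> 0" unfolding b_def by (simp add: sum_nonneg)
    have ineq: "2 * a \<le> t * b" if t: "0 < t" "t \<le> 1" for t
    proof -
      have "(1 - t) *\<^sub>R x0 + t *\<^sub>R x \<in> K"
        using K x x0 t by (auto simp: cwk_def convex_alt)
      note min[OF this]
      moreover have "y i ((1 - t) *\<^sub>R x0 + t *\<^sub>R x) - c i = t * d i - l i" for i
        by (simp add: d_def l_def blinfun.add_right blinfun.scaleR_right left_diff_distrib right_diff_distrib)
      ultimately have "(\<Sum>i\<in>F. (l i)\<^sup>2) \<le> (\<Sum>i\<in>F. (t * d i - l i)\<^sup>2)"
        unfolding q_def l_def by (simp add: power2_commute[of "y _ x0"])
      also have "\<dots> = (\<Sum>i\<in>F. (l i)\<^sup>2) + t * (t * b - 2 * a)"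
        unfolding a_def b_def
        by (simp add: power2_eq_square algebra_simps sum.distrib sum_subtractf sum_distrib_left)
      finally have "0 \<le> t * (t * b - 2 * a)" by simp
      then show ?thesis using t by (simp add: zero_le_mult_iff)
    qed
    have "a \<le> 0"
    proof (rule ccontr)
      assume a: "\<not> a \<le> 0"
      define t where "t = min 1 (a / (b + 1))"
      have "t * b \<le> a / (b + 1) * b"
        unfolding t_def using b by (intro mult_right_mono) auto
      also have "\<dots> \<le> a"
        using a b by (simp add: field_simps)
      finally show False
        using ineq[of t] a b by (auto simp: t_def)
    qed
    then show ?thesis
      unfolding a_def d_def by (simp add: algebra_simps sum_subtractf)
  qed
  have "(\<Sum>i\<in>F. l i * c i) \<le> support_fun (\<Sum>i\<in>F. l i *\<^sub>R y i) K"
    by (rule H)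
  also have "\<dots> \<le> (\<Sum>i\<in>F. l i * y i x0)"
    using variational by (intro support_fun_least[OF K])
      (simp add: blinfun.sum_left blinfun.scaleR_left)
  finally have "(\<Sum>i\<in>F. (l i)\<^sup>2) \<le> 0"
    by (simp add: l_def power2_eq_square algebra_simps sum_subtractf sum.distrib sum_distrib_left)
  then have "(\<Sum>i\<in>F. (l i)\<^sup>2) = 0"
    by (simp add: sum_nonneg antisym)
  then have "\<forall>i\<in>F. l i = 0"
    using F by (simp add: sum_nonneg_eq_0_iff)
  with x0 show ?thesis
    by (auto simp: l_def)
qed

text \<open>
  Compactness turns solvability of every finite subsystem into solvability of the whole system.
\<close>
lemma cwk_moments:
  fixes y :: "'i \<Rightarrow> 'x::real_normed_vector \<Rightarrow>\<^sub>L real"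
  assumes K: "K \<in> cwk"
    and H: "\<And>F l. finite F \<Longrightarrow> F \<subseteq> I \<Longrightarrow>
      (\<Sum>i\<in>F. l i * c i) \<le> support_fun (\<Sum>i\<in>F. l i *\<^sub>R y i) K"
  shows "\<exists>x\<in>K. \<forall>i\<in>I. y i x = c i"
proof -
  let ?S = "\<lambda>i. {x. y i x = c i}"
  have "closedin weak_topology (?S i)" for i
    using closedin_continuous_map_preimage[OF continuous_map_weak_functional, of "{c i}" "y i"] by simp
  moreover have "K \<inter> \<Inter>\<F> \<noteq> {}" if "finite \<F>" "\<F> \<subseteq> ?S ` I" for \<F>
  proof -
    obtain F where F: "finite F" "F \<subseteq> I" "\<F> = ?S ` F"
      using finite_subset_image[OF \<open>finite \<F>\<close> \<open>\<F> \<subseteq> ?S ` I\<close>] by blast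
    show ?thesis
      using cwk_finite_moments[OF K F(1) H[OF F(1,2)]] F(3) by auto
  qed
  ultimately have "K \<inter> \<Inter>(?S ` I) \<noteq> {}"
    using K[unfolded cwk_def] compactin_fip[of weak_topology K] by auto
  then show ?thesis by auto
qed

text \<open>
  For sequences of equations, rational coefficients suffice, because a support function is Lipschitz
  on the span of finitely many functionals. There are only countably many such conditions, so they
  can be imposed almost everywhere.
\<close>
lemma cwk_rational_moments:
  fixes y :: "nat \<Rightarrow> 'x::real_normed_vector \<Rightarrow>\<^sub>L real"
  assumes K: "K \<in> cwk"
    and H: "\<And>q :: rat list. (\<Sum>i<length q. of_rat (q ! i) * c i)
      \<le> support_fun (\<Sum>i<length q. of_rat (q ! i) *\<^sub>R y i) K"
  shows "\<exists>x\<in>K. \<forall>i. y i x = c i"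
proof -
  have real_combination: "(\<Sum>i<n. l i * c i) \<le> support_fun (\<Sum>i<n. l i *\<^sub>R y i) K" for n and l :: "nat \<Rightarrow> real"
  proof -
    define M where "M i = \<bar>support_fun (y i) K\<bar> + \<bar>support_fun (- y i) K\<bar>" for i
    have scale: "support_fun (a *\<^sub>R y i) K \<le> \<bar>a\<bar> * M i" for a i
    proof (cases "a \<ge> 0")
      case True
      then show ?thesis
        by (auto simp: support_fun_scaleR[OF K] M_def intro!: mult_left_mono)
    next
      case False
      then have "support_fun (a *\<^sub>R y i) K = (- a) * support_fun (- y i) K"
        using support_fun_scaleR[OF K, of "- a" "- y i"] by simp
      also have "\<dots> \<le> (- a) * M i"
        using False unfolding M_def by (intro mult_left_mono) auto
      finally show ?thesis using False by simp
    qed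
    have sum: "support_fun (\<Sum>i<n. a i *\<^sub>R y i) K \<le> (\<Sum>i<n. \<bar>a i\<bar> * M i)" for a n
    proof (induction n)
      case 0
      show ?case by (simp add: support_fun_zero[OF K])
    next
      case (Suc n)
      have "support_fun ((\<Sum>i<n. a i *\<^sub>R y i) + a n *\<^sub>R y n) K
          \<le> support_fun (\<Sum>i<n. a i *\<^sub>R y i) K + support_fun (a n *\<^sub>R y n) K"
        by (rule support_fun_add[OF K])
      then show ?case
        using Suc scale[of "a n" n] by simp
    qed
    have "\<exists>q :: nat \<Rightarrow> rat. (\<lambda>k. of_rat (q k)) \<longlonglongrightarrow> (l i :: real)" for i
    proof -
      have "\<exists>q :: rat. \<bar>of_rat q - l i\<bar> < inverse (Suc k)" for k :: nat
      proof -
        have "l i - inverse (real (Suc k)) < l i + inverse (real (Suc k))"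
          by simp
        then obtain r where r: "r \<in> \<rat>" "l i - inverse (real (Suc k)) < r" "r < l i + inverse (real (Suc k))"
          using Rats_dense_in_real by blast
        obtain q where "r = of_rat q"
          using r(1) by (rule Rats_cases)
        with r(2,3) have "\<bar>of_rat q - l i\<bar> < inverse (real (Suc k))"
          by (simp only: abs_less_iff) linarith
        then show ?thesis by blast
      qed
      then obtain q :: "nat \<Rightarrow> rat" where "\<And>k. \<bar>of_rat (q k) - l i\<bar> < inverse (Suc k)"
        by metis
      then have "(\<lambda>k. of_rat (q k) - l i) \<longlonglongrightarrow> 0"
        by (intro Lim_null_comparison[OF _ LIMSEQ_inverse_real_of_nat]) (auto intro!: always_eventually less_imp_le simp del: of_nat_Suc)
      then show ?thesis
        by (auto simp: LIM_zero_iff)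
    qed
    then obtain q :: "nat \<Rightarrow> nat \<Rightarrow> rat" where q: "\<And>i. (\<lambda>k. of_rat (q i k)) \<longlonglongrightarrow> l i"
      by metis
    have "(\<Sum>i<n. of_rat (q i k) * c i)
        \<le> support_fun (\<Sum>i<n. l i *\<^sub>R y i) K + (\<Sum>i<n. \<bar>of_rat (q i k) - l i\<bar> * M i)" for k
    proof -
      have "(\<Sum>i<n. of_rat (q i k) * c i) \<le> support_fun (\<Sum>i<n. of_rat (q i k) *\<^sub>R y i) K"
        using H[of "map (\<lambda>i. q i k) [0..<n]"] by simp
      also have "(\<Sum>i<n. of_rat (q i k) *\<^sub>R y i)
          = (\<Sum>i<n. l i *\<^sub>R y i) + (\<Sum>i<n. (of_rat (q i k) - l i) *\<^sub>R y i)"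
        by (simp add: scaleR_left_diff_distrib sum_subtractf)
      also have "support_fun \<dots> K \<le> support_fun (\<Sum>i<n. l i *\<^sub>R y i) K
          + support_fun (\<Sum>i<n. (of_rat (q i k) - l i) *\<^sub>R y i) K"
        by (rule support_fun_add[OF K])
      finally show ?thesis
        using sum[of "\<lambda>i. of_rat (q i k) - l i" n] by linarith
    qed
    moreover have "(\<lambda>k. \<Sum>i<n. of_rat (q i k) * c i) \<longlonglongrightarrow> (\<Sum>i<n. l i * c i)"
      by (intro tendsto_intros q)
    moreover have "(\<lambda>k. support_fun (\<Sum>i<n. l i *\<^sub>R y i) K + (\<Sum>i<n. \<bar>of_rat (q i k) - l i\<bar> * M i))
        \<longlonglongrightarrow> support_fun (\<Sum>i<n. l i *\<^sub>R y i) K + (\<Sum>i<n. \<bar>l i - l i\<bar> * M i)"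
      by (intro tendsto_intros q)
    ultimately show ?thesis
      using LIMSEQ_le by fastforce
  qed
  have "\<exists>x\<in>K. \<forall>i\<in>UNIV. y i x = c i"
  proof (rule cwk_moments[OF K])
    fix F :: "nat set" and l :: "nat \<Rightarrow> real"
    assume "finite F"
    then obtain n where n: "F \<subseteq> {..<n}"
      by (rule finite_nat_iff_bounded[THEN iffD1, THEN exE])
    let ?l = "\<lambda>i. if i \<in> F then l i else 0"
    have "(\<Sum>i\<in>F. l i * c i) = (\<Sum>i<n. ?l i * c i)"
      using n by (intro sum.mono_neutral_cong_left) auto
    also have "\<dots> \<le> support_fun (\<Sum>i<n. ?l i *\<^sub>R y i) K"
      by (rule real_combination)
    also have "(\<Sum>i<n. ?l i *\<^sub>R y i) = (\<Sum>i\<in>F. l i *\<^sub>R y i)"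
      using n by (intro sum.mono_neutral_cong_right) auto
    finally show "(\<Sum>i\<in>F. l i * c i) \<le> support_fun (\<Sum>i\<in>F. l i *\<^sub>R y i) K" .
  qed
  then show ?thesis by blast
qed

text \<open>
  Applied to all functionals at once, with the values of \<open>L\<close> as right-hand sides, the moment lemma
  says that a weakly compact convex set is its own closure in the algebraic dual of the dual.
\<close>
lemma dominated_by_support_fun_is_evaluation:
  fixes L :: "('x::real_normed_vector \<Rightarrow>\<^sub>L real) \<Rightarrow> real"
  assumes K: "K \<in> cwk" and L: "linear L" and le: "\<And>y. L y \<le> support_fun y K"
  shows "\<exists>x\<in>K. \<forall>y. L y = blinfun_apply y x"
proof -
  have "(\<Sum>y\<in>F. l y * L y) \<le> support_fun (\<Sum>y\<in>F. l y *\<^sub>R y) K" for F l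
    using le[of "\<Sum>y\<in>F. l y *\<^sub>R y"] by (simp add: linear_sum[OF L] linear_cmul[OF L])
  then have "\<exists>x\<in>K. \<forall>y\<in>UNIV. blinfun_apply y x = L y"
    by (rule cwk_moments[OF K])
  then obtain x where "x \<in> K" "\<And>y. blinfun_apply y x = L y" by blast
  then show ?thesis by (intro bexI[of _ x]) simp_all
qed

text \<open>
  The linear functionals below \<open>\<phi>\<close> form a closed subset of a product of compact intervals, hence a
  compact set for pointwise convergence. When all of them are evaluations, this set is a weakly
  compact subset of the space itself, and Hahn-Banach shows that its support function reaches \<open>\<phi>\<close>.
\<close>
lemma cwk_of_sublinear:
  fixes \<phi> :: "('x::real_normed_vector \<Rightarrow>\<^sub>L real) \<Rightarrow> real"
  assumes \<phi>: "sublinear_on UNIV \<phi>"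
    and ev: "\<And>L. linear L \<Longrightarrow> (\<And>y. L y \<le> \<phi> y) \<Longrightarrow> \<exists>x. \<forall>y. L y = blinfun_apply y x"
  shows "\<exists>C\<in>cwk. \<forall>y. support_fun y C = \<phi> y"
proof -
  define C where "C = {x. \<forall>y. blinfun_apply y x \<le> \<phi> y}"
  define \<Psi> where "\<Psi> = {L. linear L \<and> (\<forall>y. L y \<le> \<phi> y)}"
  have attain: "\<exists>x\<in>C. blinfun_apply y x = \<phi> y" for y
  proof -
    obtain L where L: "linear L" "\<And>z. L z \<le> \<phi> z" "L y = \<phi> y"
      using dominated_functional_attaining[OF \<phi>] by blast
    obtain x where x: "\<And>z. L z = blinfun_apply z x"
      using ev[OF L(1,2)] by blast
    have "x \<in> C" "blinfun_apply y x = \<phi> y"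
      using L(2,3) unfolding C_def x by simp_all
    then show ?thesis by blast
  qed
  have conv: "convex C"
    unfolding C_def convex_alt
  proof (intro ballI allI impI CollectI, elim conjE)
    fix a b :: 'x and u :: real and y
    assume "a \<in> {x. \<forall>y. blinfun_apply y x \<le> \<phi> y}" "b \<in> {x. \<forall>y. blinfun_apply y x \<le> \<phi> y}"
      and u: "0 \<le> u" "u \<le> 1"
    then show "blinfun_apply y ((1 - u) *\<^sub>R a + u *\<^sub>R b) \<le> \<phi> y"
      by (auto simp: blinfun.add_right blinfun.scaleR_right intro!: convex_bound_le)
  qed
  let ?box = "PiE UNIV (\<lambda>y. {- \<phi> (- y)..\<phi> y})"
  have "compactin (product_topology (\<lambda>y. euclideanreal) UNIV) ?box"
    by (subst compactin_PiE) auto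
  then have box: "compact ?box"
    by (simp add: euclidean_product_topology)
  have "\<Psi> = ?box \<inter> ((\<Inter>y. \<Inter>z. {L. L (y + z) = L y + L z}) \<inter> (\<Inter>c. \<Inter>y. {L. L (c *\<^sub>R y) = c * L y}))"
    (is "_ = ?box \<inter> ?lin")
  proof (intro equalityI subsetI)
    fix L assume L: "L \<in> \<Psi>"
    then have "- \<phi> (- y) \<le> L y" for y
      using linear_neg[of L y] unfolding \<Psi>_def by (smt (verit) mem_Collect_eq)
    then have "L \<in> ?box"
      using L by (auto simp: \<Psi>_def)
    moreover have "L \<in> ?lin"
      using L by (auto simp: \<Psi>_def linear_iff)
    ultimately show "L \<in> ?box \<inter> ?lin" by blast
  qed (auto simp: \<Psi>_def linear_iff PiE_def Pi_def)
  moreover have "closed ?lin"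
    by (intro closed_Int closed_INT ballI closed_Collect_eq continuous_intros
        continuous_on_product_coordinates)
  ultimately have \<Psi>: "compact \<Psi>"
    using box by (simp add: compact_Int_closed)
  define g where "g L = (SOME x. \<forall>y. L y = blinfun_apply y x)" for L :: "('x \<Rightarrow>\<^sub>L real) \<Rightarrow> real"
  have g: "blinfun_apply y (g L) = L y" if "L \<in> \<Psi>" for L y
  proof -
    have "\<exists>x. \<forall>y. L y = blinfun_apply y x"
      using that by (intro ev) (simp_all add: \<Psi>_def)
    then have "\<forall>y. L y = blinfun_apply y (g L)"
      unfolding g_def by (rule someI_ex)
    then show ?thesis by metis
  qed
  have "continuous_map (top_of_set \<Psi>) weak_topology g"
    unfolding weak_topology_def
  proof (rule continuous_on_generated_topo)
    fix W assume "W \<in> {blinfun_apply f -` U | (f :: 'x \<Rightarrow>\<^sub>L real) U. open U}"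
    then obtain f :: "'x \<Rightarrow>\<^sub>L real" and U where W: "W = blinfun_apply f -` U" "open U"
      by blast
    have "blinfun_apply f (g L) \<in> U \<longleftrightarrow> L f \<in> U" if "L \<in> \<Psi>" for L
      by (simp only: g[OF that])
    then have "g -` W \<inter> topspace (top_of_set \<Psi>) = \<Psi> \<inter> (\<lambda>L. L f) -` U"
      unfolding W(1) topspace_euclidean_subtopology by blast
    moreover have "open ((\<lambda>L :: ('x \<Rightarrow>\<^sub>L real) \<Rightarrow> real. L f) -` U)"
      using W(2) by (intro open_vimage continuous_on_product_coordinates)
    ultimately show "openin (top_of_set \<Psi>) (g -` W \<inter> topspace (top_of_set \<Psi>))"
      by (simp add: openin_open_Int)
  next
    show "g ` topspace (top_of_set \<Psi>) \<subseteq> \<Union> {blinfun_apply f -` U | (f :: 'x \<Rightarrow>\<^sub>L real) U. open U}"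
      using topspace_weak_topology[where 'x='x]
      unfolding weak_topology_def topology_generated_by_topspace by auto
  qed
  then have "compactin weak_topology (g ` \<Psi>)"
    using \<Psi> by (intro image_compactin[of "top_of_set \<Psi>"]) (auto simp: compactin_subtopology)
  moreover have "g ` \<Psi> = C"
  proof (intro equalityI subsetI)
    fix x assume "x \<in> g ` \<Psi>"
    then obtain L where L: "L \<in> \<Psi>" "x = g L" by blast
    from L(1) have "L y \<le> \<phi> y" for y by (simp add: \<Psi>_def)
    then show "x \<in> C"
      using g[OF L(1)] by (simp add: C_def L(2))
  next
    fix x assume x: "x \<in> C"
    let ?L = "\<lambda>y. blinfun_apply y x"
    have L: "?L \<in> \<Psi>"
      using x by (auto simp: \<Psi>_def C_def linear_iff blinfun.add_left blinfun.scaleR_left)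
    obtain f :: "'x \<Rightarrow>\<^sub>L real" where "f (x - g ?L) = norm (x - g ?L)"
      using norming_functional by blast
    then have "x = g ?L"
      using g[OF L, of f] by (simp add: blinfun.diff_right)
    then show "x \<in> g ` \<Psi>"
      using L by blast
  qed
  ultimately have cwk: "C \<in> cwk"
    using conv attain by (auto simp: cwk_def)
  have "support_fun y C = \<phi> y" for y
  proof (rule antisym)
    show "support_fun y C \<le> \<phi> y"
      using cwk by (intro support_fun_least) (auto simp: C_def)
    show "\<phi> y \<le> support_fun y C"
      using attain[of y] support_fun_upper[OF cwk, of _ y] by force
  qed
  with cwk show ?thesis by blast
qed

section \<open>Densities and almost everywhere convergence\<close>

lemma AE_le_from_set_integrals:
  fixes f g :: "'w \<Rightarrow> real"
  assumes f: "integrable m f" and g: "integrable m g"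
    and le: "\<And>B. B \<in> sets m \<Longrightarrow> (LINT t:B|m. f t) \<le> (LINT t:B|m. g t)"
  shows "AE t in m. f t \<le> g t"
proof -
  have [measurable]: "f \<in> borel_measurable m" "g \<in> borel_measurable m"
    using f g by auto
  define B where "B = {t \<in> space m. g t < f t}"
  have B [measurable]: "B \<in> sets m" unfolding B_def by measurable
  let ?h = "\<lambda>t. indicator B t * (f t - g t)"
  have int: "integrable m ?h"
    using integrable_mult_indicator[OF B, of "\<lambda>t. f t - g t"] f g by simp
  have "(\<integral>t. ?h t \<partial>m) = (LINT t:B|m. f t) - (LINT t:B|m. g t)"
    using integrable_mult_indicator[OF B f] integrable_mult_indicator[OF B g]
    unfolding set_lebesgue_integral_def by (simp add: right_diff_distrib)
  also have "\<dots> \<le> 0" using le[OF B] by simp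
  finally have "(\<integral>t. ?h t \<partial>m) \<le> 0" .
  moreover have nonneg: "AE t in m. 0 \<le> ?h t"
    by (auto simp: B_def indicator_def)
  ultimately have "(\<integral>t. ?h t \<partial>m) = 0"
    using integral_nonneg_AE[OF nonneg] by linarith
  then have "AE t in m. ?h t = 0"
    using integral_nonneg_eq_0_iff_AE[OF int nonneg] by simp
  then show ?thesis
    using AE_space
  proof eventually_elim
    case (elim t)
    then show ?case
      by (cases "t \<in> B") (auto simp: B_def)
  qed
qed

lemma set_integral_tendsto_0_decseq:
  fixes w :: "'w \<Rightarrow> real"
  assumes w: "integrable m w" and A: "range A \<subseteq> sets m" "decseq A" "(\<Inter>i. A i) = {}"
  shows "(\<lambda>i. LINT t:A i|m. w t) \<longlonglongrightarrow> 0"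
proof -
  have "(\<lambda>i. \<integral>t. indicator (A i) t *\<^sub>R w t \<partial>m) \<longlonglongrightarrow> (\<integral>t. 0 \<partial>m)"
  proof (rule integral_dominated_convergence)
    show "AE t in m. (\<lambda>i. indicator (A i) t *\<^sub>R w t) \<longlonglongrightarrow> 0"
    proof (rule AE_I2)
      fix t
      obtain i where "t \<notin> A i" using A(3) by blast
      then have "\<forall>j\<ge>i. indicator (A j) t *\<^sub>R w t = 0"
        using A(2) by (auto simp: decseq_def indicator_def)
      then show "(\<lambda>i. indicator (A i) t *\<^sub>R w t) \<longlonglongrightarrow> 0"
        by (intro tendsto_eventually) (auto simp: eventually_sequentially)
    qed
    show "integrable m (\<lambda>t. norm (w t))" using w by simp
    show "(\<lambda>t. indicator (A i) t *\<^sub>R w t) \<in> borel_measurable m" for i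
      using w A(1) by (intro borel_measurable_scaleR borel_measurable_indicator) auto
    show "AE t in m. norm (indicator (A i) t *\<^sub>R w t) \<le> norm (w t)" for i
      by (auto simp: indicator_def)
  qed simp
  then show ?thesis by (simp add: set_lebesgue_integral_def)
qed

text \<open>
  The bounds make the difference between the upper integral and \<open>\<nu>\<close> a finitely additive function
  that is dominated by a finite measure. It is therefore countably additive and absolutely
  continuous, and Radon-Nikodym applies.
\<close>
lemma additive_between_integrals_has_density:
  fixes \<nu> :: "'w set \<Rightarrow> real"
  assumes m: "finite_measure m" and l: "integrable m l" and u: "integrable m u"
    and add: "\<And>A B. A \<in> sets m \<Longrightarrow> B \<in> sets m \<Longrightarrow> A \<inter> B = {} \<Longrightarrow> \<nu> (A \<union> B) = \<nu> A + \<nu> B"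
    and lower: "\<And>B. B \<in> sets m \<Longrightarrow> (LINT t:B|m. l t) \<le> \<nu> B"
    and upper: "\<And>B. B \<in> sets m \<Longrightarrow> \<nu> B \<le> (LINT t:B|m. u t)"
  obtains f where "integrable m f" "\<And>B. B \<in> sets m \<Longrightarrow> \<nu> B = (LINT t:B|m. f t)"
proof -
  interpret finite_measure m by fact
  define \<kappa> where "\<kappa> B = (LINT t:B|m. u t) - \<nu> B" for B
  define w where "w t = u t - l t" for t
  have w: "integrable m w" unfolding w_def using l u by simp
  have set_int: "set_integrable m B h" if "B \<in> sets m" "integrable m h" for B and h :: "'w \<Rightarrow> real"
    unfolding set_integrable_def using that by (rule integrable_mult_indicator)
  have nonneg: "0 \<le> \<kappa> B" if "B \<in> sets m" for B
    using upper[OF that] by (simp add: \<kappa>_def)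
  have le_w: "\<kappa> B \<le> (LINT t:B|m. w t)" if "B \<in> sets m" for B
    using lower[OF that] set_int[OF that] l u unfolding \<kappa>_def w_def by simp
  have \<kappa>_add: "\<kappa> (A \<union> B) = \<kappa> A + \<kappa> B" if "A \<in> sets m" "B \<in> sets m" "A \<inter> B = {}" for A B
    using that add[OF that] set_integral_Un[OF that(3) set_int[OF that(1) u] set_int[OF that(2) u]]
    by (simp add: \<kappa>_def)
  have \<kappa>_empty: "\<kappa> {} = 0"
    using \<kappa>_add[of "{}" "{}"] by simp
  define N where "N = measure_of (space m) (sets m) (\<lambda>B. ennreal (\<kappa> B))"
  have sets_N [simp]: "sets N = sets m" and space_N [simp]: "space N = space m"
    by (simp_all add: N_def)
  have ca: "countably_additive (sets m) (\<lambda>B. ennreal (\<kappa> B))"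
  proof (rule sets.empty_continuous_imp_countably_additive)
    show "positive (sets m) (\<lambda>B. ennreal (\<kappa> B))"
      by (simp add: positive_def \<kappa>_empty)
    show "additive (sets m) (\<lambda>B. ennreal (\<kappa> B))"
      unfolding additive_def using \<kappa>_add nonneg by (simp add: ennreal_plus)
    fix A :: "nat \<Rightarrow> 'w set"
    assume A: "range A \<subseteq> sets m" "decseq A" "(\<Inter>i. A i) = {}"
    have Am: "A i \<in> sets m" for i using A(1) by blast
    have "(\<lambda>i. \<kappa> (A i)) \<longlonglongrightarrow> 0"
    proof (rule tendsto_sandwich[OF _ _ tendsto_const set_integral_tendsto_0_decseq[OF w A]])
      show "\<forall>\<^sub>F i in sequentially. 0 \<le> \<kappa> (A i)"
        using nonneg[OF Am] by simp
      show "\<forall>\<^sub>F i in sequentially. \<kappa> (A i) \<le> (LINT t:A i|m. w t)"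
        using le_w[OF Am] by simp
    qed
    then show "(\<lambda>i. ennreal (\<kappa> (A i))) \<longlonglongrightarrow> 0"
      using tendsto_ennrealI[of _ 0] by simp
  qed simp
  have N: "emeasure N B = ennreal (\<kappa> B)" if "B \<in> sets m" for B
  proof (rule emeasure_measure_of[OF N_def])
    show "sets m \<subseteq> Pow (space m)" by (rule sets.space_closed)
    show "positive (sets N) (\<lambda>B. ennreal (\<kappa> B))"
      by (simp add: positive_def \<kappa>_empty)
  qed (use ca that in simp_all)
  have "absolutely_continuous m N"
    unfolding absolutely_continuous_def
  proof
    fix B assume B: "B \<in> null_sets m"
    then have "(LINT t:B|m. w t) = 0"
      using AE_not_in[OF B] unfolding set_lebesgue_integral_def
      by (intro integral_eq_zero_AE) (auto elim!: eventually_mono)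
    with B le_w[of B] nonneg[of B] show "B \<in> null_sets N"
      by (auto simp: null_sets_def N)
  qed
  then obtain f where f [measurable]: "f \<in> borel_measurable m" and dens: "density m f = N"
    using Radon_Nikodym[of N] by auto
  have f_int: "(\<integral>\<^sup>+t. f t * indicator B t \<partial>m) = ennreal (\<kappa> B)" if "B \<in> sets m" for B
    using emeasure_density[OF f that] N[OF that] dens by simp
  define d where "d t = enn2real (f t)" for t
  have d [measurable]: "d \<in> borel_measurable m" unfolding d_def by measurable
  have "(\<integral>\<^sup>+t. f t \<partial>m) = (\<integral>\<^sup>+t. f t * indicator (space m) t \<partial>m)"
    by (intro nn_integral_cong) auto
  then have "(\<integral>\<^sup>+t. f t \<partial>m) \<noteq> \<infinity>"
    using f_int[of "space m"] by simp
  then have fin: "AE t in m. f t \<noteq> \<infinity>"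
    by (intro nn_integral_noteq_infinite f)
  have d_nn: "(\<integral>\<^sup>+t. ennreal (indicator B t *\<^sub>R d t) \<partial>m) = ennreal (\<kappa> B)" if "B \<in> sets m" for B
    unfolding f_int[OF that, symmetric]
    using fin by (intro nn_integral_cong_AE)
      (auto elim!: eventually_mono simp: d_def indicator_def ennreal_enn2real_if)
  have d_int: "(LINT t:B|m. d t) = \<kappa> B" if B: "B \<in> sets m" for B
    unfolding set_lebesgue_integral_def
    by (rule integral_eq_nn_integral[THEN trans])
      (use B nonneg[OF B] d_nn[OF B] in \<open>auto simp: d_def indicator_def\<close>)
  have "integrable m (\<lambda>t. indicator (space m) t *\<^sub>R d t)"
    using d_nn[of "space m"] by (intro integrableI_nonneg) (auto simp: d_def indicator_def)
  then have d_integrable: "integrable m d"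
    by (rule Bochner_Integration.integrable_cong[THEN iffD1, rotated -1]) auto
  show thesis
  proof
    show "integrable m (\<lambda>t. u t - d t)" using u d_integrable by simp
    show "\<nu> B = (LINT t:B|m. u t - d t)" if "B \<in> sets m" for B
      using set_int[OF that u] set_int[OF that d_integrable] d_int[OF that] by (simp add: \<kappa>_def)
  qed
qed

text \<open>
  Mazur's theorem in \<open>L\<^sup>2\<close>: nearly minimising the \<open>L\<^sup>2\<close> norm over the convex hulls of the tails gives
  a Cauchy sequence by the parallelogram identity, and the choice of rapidly decreasing errors turns
  this into convergence almost everywhere. Stating it for \<open>T y t\<close> with \<open>y\<close> in a vector space
  keeps the convex combinations on the level of \<open>y\<close>, independent of \<open>t\<close>.
\<close>
lemma convex_tails_converge_AE:
  fixes z :: "nat \<Rightarrow> 'y::real_vector" and T :: "'y \<Rightarrow> 'w \<Rightarrow> real"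
  assumes m: "finite_measure m" and lin: "\<And>t. linear (\<lambda>y. T y t)"
    and meas: "\<And>k. T (z k) \<in> borel_measurable m" and bd: "\<And>k t. \<bar>T (z k) t\<bar> \<le> R"
  obtains y where "\<And>k. y k \<in> convex hull (z ` {k..})"
    "\<And>k. T (y k) \<in> borel_measurable m" "\<And>k t. \<bar>T (y k) t\<bar> \<le> R"
    "AE t in m. convergent (\<lambda>k. T (y k) t)"
proof -
  interpret finite_measure m by fact
  define D where "D k = convex hull (z ` {k..})" for k
  define J where "J y = (\<integral>t. (T y t)\<^sup>2 \<partial>m)" for y
  have T_add: "T (a + b) t = T a t + T b t" and T_scale: "T (c *\<^sub>R a) t = c * T a t" for a b c t
    using linear_add[OF lin] linear_cmul[OF lin] by auto
  have D_mono: "D k \<subseteq> D j" if "j \<le> k" for j k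
    unfolding D_def using that by (intro hull_mono image_mono) auto
  have D_good: "T y \<in> borel_measurable m \<and> (\<forall>t. \<bar>T y t\<bar> \<le> R)" if "y \<in> D k" for y k
  proof -
    have "convex {y. T y \<in> borel_measurable m \<and> (\<forall>t. \<bar>T y t\<bar> \<le> R)}"
      unfolding convex_alt
    proof (intro ballI allI impI CollectI conjI)
      fix a b and v :: real
      assume a: "a \<in> {y. T y \<in> borel_measurable m \<and> (\<forall>t. \<bar>T y t\<bar> \<le> R)}"
        and b: "b \<in> {y. T y \<in> borel_measurable m \<and> (\<forall>t. \<bar>T y t\<bar> \<le> R)}" and v: "0 \<le> v \<and> v \<le> 1"
      have eq: "T ((1 - v) *\<^sub>R a + v *\<^sub>R b) = (\<lambda>t. (1 - v) * T a t + v * T b t)"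
        by (simp add: T_add T_scale fun_eq_iff)
      show "T ((1 - v) *\<^sub>R a + v *\<^sub>R b) \<in> borel_measurable m"
        unfolding eq using a b by auto
      fix t
      have "\<bar>(1 - v) * T a t + v * T b t\<bar> \<le> (1 - v) * \<bar>T a t\<bar> + v * \<bar>T b t\<bar>"
        using v abs_triangle_ineq[of "(1 - v) * T a t" "v * T b t"] by (simp add: abs_mult)
      also have "\<dots> \<le> R"
        using a b v by (intro convex_bound_le) auto
      finally show "\<bar>T ((1 - v) *\<^sub>R a + v *\<^sub>R b) t\<bar> \<le> R"
        by (simp add: eq)
    qed
    then have "convex hull (z ` {k..}) \<subseteq> {y. T y \<in> borel_measurable m \<and> (\<forall>t. \<bar>T y t\<bar> \<le> R)}"
      using meas bd by (intro hull_minimal) auto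
    then show ?thesis using that by (auto simp: D_def)
  qed
  have sq_int: "integrable m (\<lambda>t. T a t * T b t)" if "a \<in> D j" "b \<in> D k" for a b j k
  proof (rule integrable_const_bound[where B="R * R"])
    show "AE t in m. norm (T a t * T b t) \<le> R * R"
    proof (rule AE_I2)
      fix t show "norm (T a t * T b t) \<le> R * R"
        using D_good[OF that(1)] D_good[OF that(2)]
        by (simp add: abs_mult) (meson abs_ge_zero mult_mono order_trans)
    qed
    show "(\<lambda>t. T a t * T b t) \<in> borel_measurable m"
      using D_good[OF that(1)] D_good[OF that(2)] by (intro borel_measurable_times) auto
  qed
  have z_in: "z k \<in> D k" for k
    unfolding D_def by (intro hull_inc) auto
  have J_bd: "J y \<le> R\<^sup>2 * measure m (space m)" if "y \<in> D k" for y k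
  proof -
    have "J y \<le> (\<integral>t. R\<^sup>2 \<partial>m)"
      unfolding J_def
    proof (rule integral_mono)
      show "(T y t)\<^sup>2 \<le> R\<^sup>2" for t
        using D_good[OF that] power_mono[of "\<bar>T y t\<bar>" R 2] by simp
    qed (use sq_int[OF that that] in \<open>simp_all add: power2_eq_square\<close>)
    then show ?thesis by (simp add: mult.commute)
  qed
  have J_nonneg: "0 \<le> J y" for y
    unfolding J_def by simp
  define I where "I k = Inf (J ` D k)" for k
  have bdd: "bdd_below (J ` D k)" for k
    using J_nonneg by (intro bdd_belowI[of _ 0]) auto
  have I_le: "I k \<le> J y" if "y \<in> D k" for y k
    unfolding I_def using that bdd by (intro cInf_lower) auto
  have "J ` D k \<noteq> {}" for k
    using z_in by blast
  then have "incseq I"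
    unfolding I_def using D_mono bdd
    by (intro monoI cInf_superset_mono image_mono) auto
  moreover have "I k \<le> R\<^sup>2 * measure m (space m)" for k
    using I_le[OF z_in] J_bd[OF z_in] order_trans by blast
  ultimately obtain Ilim where lim: "I \<longlonglongrightarrow> Ilim" and I_le_lim: "\<And>k. I k \<le> Ilim"
    using incseq_convergent by metis
  have "\<exists>N\<ge>k. \<exists>y\<in>D N. Ilim - (1/4)^k < I N \<and> J y < Ilim + (1/4)^k" for k :: nat
  proof -
    have "\<forall>\<^sub>F N in sequentially. Ilim - (1/4)^k < I N"
      using lim by (rule order_tendstoD) simp
    then have "\<forall>\<^sub>F N in sequentially. Ilim - (1/4)^k < I N \<and> k \<le> N"
      by (intro eventually_conj eventually_ge_at_top)
    then obtain N where N: "N \<ge> k" "Ilim - (1/4)^k < I N"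
      by (auto simp: eventually_sequentially)
    have "I N < Ilim + (1/4)^k"
      using I_le_lim[of N] by (simp add: le_less_trans)
    then have "\<exists>y\<in>D N. J y < Ilim + (1/4)^k"
      unfolding I_def using bdd z_in by (subst (asm) cInf_less_iff) auto
    with N show ?thesis by blast
  qed
  then obtain N y where N: "\<And>k. N k \<ge> k" and yN: "\<And>k. y k \<in> D (N k)"
    and I_N: "\<And>k. Ilim - (1/4)^k < I (N k)" and J_y: "\<And>k. J (y k) < Ilim + (1/4)^k"
    by metis
  define d where "d k t = T (y (Suc k)) t - T (y k) t" for k t
  have d_meas [measurable]: "d k \<in> borel_measurable m" for k
    unfolding d_def using D_good yN by (intro borel_measurable_diff) auto
  have d_sq_int: "integrable m (\<lambda>t. (d k t)\<^sup>2)" for k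
    unfolding d_def power2_eq_square left_diff_distrib right_diff_distrib
    by (intro Bochner_Integration.integrable_diff sq_int[OF yN yN])
  \<comment> \<open>Both \<open>y k\<close> and \<open>y (Suc k)\<close> are nearly minimal, and their midpoint, lying in the hull of an
    equally late tail, cannot be much smaller than the limit \<open>Ilim\<close> of the minimal values.\<close>
  have d_sq: "(\<integral>t. (d k t)\<^sup>2 \<partial>m) \<le> 8 * (1/4)^k" for k
  proof -
    define M where "M = min (N k) (N (Suc k))"
    define mid where "mid = (1/2) *\<^sub>R y k + (1/2) *\<^sub>R y (Suc k)"
    have yM: "y k \<in> D M" "y (Suc k) \<in> D M"
      using yN D_mono[of M] unfolding M_def by (meson min.cobounded1 min.cobounded2 subsetD)+
    then have mid: "mid \<in> D M"
      unfolding mid_def D_def by (intro convexD) auto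
    have small: "(1/4::real)^Suc k \<le> (1/4)^k"
      by simp
    have "Ilim - (1/4)^k \<le> I M"
      using I_N[of k] I_N[of "Suc k"] small unfolding M_def min_def by (smt (verit))
    also have "\<dots> \<le> J mid"
      using mid by (rule I_le)
    finally have J_mid: "Ilim - (1/4)^k \<le> J mid" .
    have "(d k t)\<^sup>2 = 2 * (T (y (Suc k)) t * T (y (Suc k)) t) + 2 * (T (y k) t * T (y k) t)
        - 4 * (T mid t * T mid t)" for t
      by (simp add: d_def mid_def T_add T_scale power2_eq_square algebra_simps)
    then have "(\<integral>t. (d k t)\<^sup>2 \<partial>m) = 2 * J (y (Suc k)) + 2 * J (y k) - 4 * J mid"
      unfolding J_def power2_eq_square
      using sq_int[OF yN yN] sq_int[OF mid mid] by simp
    also have "\<dots> \<le> 8 * (1/4)^k"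
      using J_mid J_y[of k] J_y[of "Suc k"] small by linarith
    finally show ?thesis .
  qed
  \<comment> \<open>The bound \<open>|d| \<le> s + d\<^sup>2 / s\<close> with \<open>s = 2\<^sup>-\<^sup>k\<close> passes from the square integrals to summable
    integrals of the increments.\<close>
  have d_nn: "(\<integral>\<^sup>+t. ennreal \<bar>d k t\<bar> \<partial>m) \<le> ennreal ((measure m (space m) + 8) * (1/2)^k)" for k
  proof -
    have pt: "\<bar>d k t\<bar> \<le> (1/2)^k + 2^k * (d k t)\<^sup>2" for t
    proof (cases "\<bar>d k t\<bar> \<le> (1/2)^k")
      case True
      then show ?thesis by (simp add: add_increasing2)
    next
      case False
      have "1 = 2^k * (1/2::real)^k"
        by (simp add: power_one_over)
      also have "\<dots> \<le> 2^k * \<bar>d k t\<bar>"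
        using False by (intro mult_left_mono) auto
      finally have "1 * \<bar>d k t\<bar> \<le> (2^k * \<bar>d k t\<bar>) * \<bar>d k t\<bar>"
        by (intro mult_right_mono) auto
      then show ?thesis
        by (simp add: power2_eq_square mult.assoc add_increasing)
    qed
    have "(\<integral>t. (1/2)^k + 2^k * (d k t)\<^sup>2 \<partial>m)
        = (1/2)^k * measure m (space m) + 2^k * (\<integral>t. (d k t)\<^sup>2 \<partial>m)"
      using d_sq_int by simp
    also have "\<dots> \<le> (1/2)^k * measure m (space m) + 2^k * (8 * (1/4)^k)"
      using d_sq by (intro add_left_mono mult_left_mono) auto
    also have "2^k * (8 * (1/4::real)^k) = 8 * (1/2)^k"
      by (simp add: power_mult_distrib[symmetric])
    finally have le: "(\<integral>t. (1/2)^k + 2^k * (d k t)\<^sup>2 \<partial>m) \<le> (measure m (space m) + 8) * (1/2)^k"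
      by (simp add: algebra_simps)
    have "(\<integral>\<^sup>+t. ennreal \<bar>d k t\<bar> \<partial>m) \<le> (\<integral>\<^sup>+t. ennreal ((1/2)^k + 2^k * (d k t)\<^sup>2) \<partial>m)"
      using pt by (intro nn_integral_mono ennreal_leI) auto
    also have "\<dots> = ennreal (\<integral>t. (1/2)^k + 2^k * (d k t)\<^sup>2 \<partial>m)"
      using d_sq_int by (intro nn_integral_eq_integral) auto
    also have "\<dots> \<le> ennreal ((measure m (space m) + 8) * (1/2)^k)"
      using le by (rule ennreal_leI)
    finally show ?thesis .
  qed
  have "(\<integral>\<^sup>+t. (\<Sum>k. ennreal \<bar>d k t\<bar>) \<partial>m) = (\<Sum>k. \<integral>\<^sup>+t. ennreal \<bar>d k t\<bar> \<partial>m)"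
    by (intro nn_integral_suminf) auto
  also have "\<dots> \<le> (\<Sum>k. ennreal ((measure m (space m) + 8) * (1/2)^k))"
    using d_nn by (intro suminf_le) auto
  also have "\<dots> < \<infinity>"
    by (subst suminf_ennreal2) (auto intro!: summable_mult simp: summable_geometric)
  finally have "AE t in m. (\<Sum>k. ennreal \<bar>d k t\<bar>) \<noteq> \<infinity>"
    by (intro nn_integral_noteq_infinite) auto
  then have conv: "AE t in m. convergent (\<lambda>k. T (y k) t)"
  proof eventually_elim
    case (elim t)
    then have "summable (\<lambda>k. \<bar>d k t\<bar>)"
      by (intro summable_suminf_not_top) auto
    then have "summable (\<lambda>k. d k t)"
      by (rule summable_rabs_cancel)
    then have "convergent (\<lambda>n. \<Sum>k<n. d k t)"
      by (simp add: summable_iff_convergent)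
    moreover have "(\<Sum>k<n. d k t) = T (y n) t - T (y 0) t" for n
      unfolding d_def by (rule sum_lessThan_telescope)
    ultimately show ?case
      by (simp add: convergent_diff_const_right_iff)
  qed
  have "y k \<in> convex hull (z ` {k..})" for k
    using D_mono[OF N[of k]] yN[of k] by (auto simp: D_def)
  moreover have "T (y k) \<in> borel_measurable m" "\<bar>T (y k) t\<bar> \<le> R" for k t
    using D_good[OF yN] by auto
  ultimately show thesis
    using conv that by blast
qed

section \<open>Disintegration of functionals below an integral\<close>

text \<open>
  With pointwise operations, the simple functions into a vector space form a subspace to which the
  Hahn-Banach theorem applies.
\<close>
instantiation "fun" :: (type, real_vector) real_vector
begin

definition scaleR_fun where "scaleR_fun c f = (\<lambda>x. c *\<^sub>R f x)"

instance
  by standard (simp_all add: scaleR_fun_def plus_fun_def scaleR_add_right scaleR_add_left)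

end

lemma integrable_support_fun_simple:
  fixes \<Gamma> :: "'w \<Rightarrow> 'x::real_normed_vector set"
  assumes \<Gamma>: "scalarly_integrable m \<Gamma>" and h: "simple_function m h"
  shows "integrable m (\<lambda>t. support_fun (h t) (\<Gamma> t))"
proof -
  have fin: "finite (h ` space m)"
    using h by (simp add: simple_function_def)
  have meas: "h -` {y} \<inter> space m \<in> sets m" for y
    using h by (rule simple_functionD)
  have "integrable m (\<lambda>t. \<Sum>y\<in>h ` space m. indicator (h -` {y} \<inter> space m) t *\<^sub>R support_fun y (\<Gamma> t))"
    using \<Gamma> meas unfolding scalarly_integrable_def
    by (intro Bochner_Integration.integrable_sum integrable_mult_indicator) auto
  moreover have "(\<Sum>y\<in>h ` space m. indicator (h -` {y} \<inter> space m) t *\<^sub>R support_fun y (\<Gamma> t))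
      = support_fun (h t) (\<Gamma> t)" if t: "t \<in> space m" for t
  proof -
    have "(\<Sum>y\<in>h ` space m. indicator (h -` {y} \<inter> space m) t *\<^sub>R support_fun y (\<Gamma> t))
        = (\<Sum>y\<in>{h t}. indicator (h -` {y} \<inter> space m) t *\<^sub>R support_fun y (\<Gamma> t))"
      using fin t by (intro sum.mono_neutral_right) (auto simp: indicator_def)
    then show ?thesis using t by simp
  qed
  ultimately show ?thesis
    by (subst Bochner_Integration.integrable_cong[OF refl]) auto
qed

text \<open>
  Strassen's disintegration: a linear functional below the integral of sublinear functionals is an
  integral of linear ones. Regard \<open>\<psi>\<close> as a functional on constant functions and extend it to all
  simple functions \<open>h\<close>, dominated by the integral of \<open>support_fun (h t) (\<Gamma> t)\<close>. Evaluated at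
  \<open>indicator B *\<^sub>R y\<close>, the extension is a measure in \<open>B\<close>, and \<open>T y\<close> is its density. Linearity in \<open>y\<close> and
  domination survive for the densities only almost everywhere, with an exceptional set that depends
  on the linear combination.
\<close>
lemma dominated_functional_has_densities:
  fixes \<Gamma> :: "'w \<Rightarrow> 'x::real_normed_vector set" and \<psi> :: "('x \<Rightarrow>\<^sub>L real) \<Rightarrow> real"
  assumes m: "finite_measure m" and \<Gamma>: "\<Gamma> \<in> space m \<rightarrow> cwk" and si: "scalarly_integrable m \<Gamma>"
    and \<psi>: "linear \<psi>" and le: "\<And>y. \<psi> y \<le> (\<integral>t. support_fun y (\<Gamma> t) \<partial>m)"
  obtains T :: "('x \<Rightarrow>\<^sub>L real) \<Rightarrow> 'w \<Rightarrow> real"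
  where "\<And>y. integrable m (T y)" "\<And>y. (\<integral>t. T y t \<partial>m) = \<psi> y"
    "\<And>F l y. finite (F :: nat set) \<Longrightarrow>
      AE t in m. (\<Sum>i\<in>F. l i * T (y i) t) \<le> support_fun (\<Sum>i\<in>F. l i *\<^sub>R y i) (\<Gamma> t)"
proof -
  interpret finite_measure m by fact
  have cwk: "\<Gamma> t \<in> cwk" if "t \<in> space m" for t using \<Gamma> that by auto
  let ?V = "{h :: 'w \<Rightarrow> 'x \<Rightarrow>\<^sub>L real. simple_function m h}"
  define p where "p h = (\<integral>t. support_fun (h t) (\<Gamma> t) \<partial>m)" for h
  have V: "subspace ?V"
    unfolding subspace_def plus_fun_def scaleR_fun_def zero_fun_def
    by (auto intro: simple_function_compose2 simple_function_compose1)
  have p: "sublinear_on ?V p"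
    unfolding sublinear_on_def
  proof (intro conjI ballI allI impI)
    fix g h :: "'w \<Rightarrow> 'x \<Rightarrow>\<^sub>L real" assume g: "g \<in> ?V"
    {
      assume h: "h \<in> ?V"
      have gh: "g + h \<in> ?V" using subspace_add[OF V g h] .
      have "p (g + h) \<le> (\<integral>t. support_fun (g t) (\<Gamma> t) + support_fun (h t) (\<Gamma> t) \<partial>m)"
        unfolding p_def using g h gh
        by (intro integral_mono Bochner_Integration.integrable_add integrable_support_fun_simple[OF si])
          (auto simp: support_fun_add[OF cwk])
      also have "\<dots> = p g + p h"
        unfolding p_def using g h
        by (intro Bochner_Integration.integral_add integrable_support_fun_simple[OF si]) auto
      finally show "p (g + h) \<le> p g + p h" .
    }
    fix c :: real assume c: "0 \<le> c"
    have "p (c *\<^sub>R g) = (\<integral>t. c * support_fun (g t) (\<Gamma> t) \<partial>m)"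
      unfolding p_def scaleR_fun_def using c
      by (intro Bochner_Integration.integral_cong refl support_fun_scaleR cwk)
    then show "p (c *\<^sub>R g) = c * p g"
      by (simp add: p_def)
  qed
  define e where "e B y = (\<lambda>t. indicator B t *\<^sub>R y)" for B :: "'w set" and y :: "'x \<Rightarrow>\<^sub>L real"
  have e_V: "e B y \<in> ?V" if "B \<in> sets m" for B y
    unfolding e_def
    using simple_function_compose1[OF simple_function_indicator[OF that], of "\<lambda>c. c *\<^sub>R y"] by simp
  have p_e: "p (e B y) = (LINT t:B|m. support_fun y (\<Gamma> t))" for B y
    unfolding p_def e_def set_lebesgue_integral_def
    by (intro Bochner_Integration.integral_cong refl) (auto simp: indicator_def support_fun_zero[OF cwk])
  let ?G = "range (\<lambda>y. (e (space m) y, \<psi> y))"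
  have "linear (\<lambda>y. (e (space m) y, \<psi> y))"
    using linear_add[OF \<psi>] linear_cmul[OF \<psi>]
    by (intro linearI) (simp_all add: e_def scaleR_fun_def plus_fun_def scaleR_add_right mult.commute)
  then have G: "subspace ?G"
    by (rule linear_subspace_image[OF _ subspace_UNIV])
  have "fst ` ?G \<subseteq> ?V"
    using e_V[OF sets.top] by auto
  moreover have "r \<le> p x" if "(x, r) \<in> ?G" for x r
    using that le si by (auto simp: p_e set_integral_space scalarly_integrable_def)
  ultimately obtain L where L: "linear_functional_on ?V L" "\<And>h. h \<in> ?V \<Longrightarrow> L h \<le> p h"
    "\<And>h r. (h, r) \<in> ?G \<Longrightarrow> L h = r"
    using hahn_banach_graph[OF V p G] by blast
  define \<nu> where "\<nu> y B = L (e B y)" for y B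
  have \<nu>_linear: "\<nu> (\<Sum>i\<in>F. l i *\<^sub>R y i) B = (\<Sum>i\<in>F. l i * \<nu> (y i) B)"
    if "B \<in> sets m" "finite F" for B and F :: "nat set" and l y
    using \<open>finite F\<close>
  proof (induction F rule: finite_induct)
    case empty
    have "L (0 *\<^sub>R e B 0) = 0 * L (e B 0)"
      using L(1) e_V[OF that(1)] unfolding linear_functional_on_def by blast
    moreover have "0 *\<^sub>R e B 0 = e B 0"
      by (simp add: e_def scaleR_fun_def)
    ultimately show ?case by (simp add: \<nu>_def)
  next
    case (insert x F)
    let ?s = "\<Sum>i\<in>F. l i *\<^sub>R y i"
    have "e B (l x *\<^sub>R y x + ?s) = l x *\<^sub>R e B (y x) + e B ?s"
      by (simp add: e_def scaleR_fun_def plus_fun_def scaleR_add_right mult.commute)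
    moreover have "L (l x *\<^sub>R e B (y x) + e B ?s) = L (l x *\<^sub>R e B (y x)) + L (e B ?s)"
      using L(1) e_V[OF that(1)] subspace_scale[OF V e_V[OF that(1)]]
      unfolding linear_functional_on_def by blast
    moreover have "L (l x *\<^sub>R e B (y x)) = l x * L (e B (y x))"
      using L(1) e_V[OF that(1)] unfolding linear_functional_on_def by blast
    ultimately show ?case
      using insert by (simp add: \<nu>_def)
  qed
  have \<nu>_upper: "\<nu> y B \<le> (LINT t:B|m. support_fun y (\<Gamma> t))" if "B \<in> sets m" for B y
    using L(2)[OF e_V[OF that]] by (simp add: \<nu>_def p_e)
  have \<nu>_minus: "\<nu> (- y) B = - \<nu> y B" if "B \<in> sets m" for B y
    using \<nu>_linear[OF that, of "{0}" "\<lambda>_. -1" "\<lambda>_. y"] by simp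
  have "\<exists>f. integrable m f \<and> (\<forall>B\<in>sets m. \<nu> y B = (LINT t:B|m. f t))" for y
  proof -
    have "\<nu> y (A \<union> B) = \<nu> y A + \<nu> y B" if "A \<in> sets m" "B \<in> sets m" "A \<inter> B = {}" for A B
    proof -
      have "e (A \<union> B) y = e A y + e B y"
      proof
        fix t show "e (A \<union> B) y t = (e A y + e B y) t"
          using that(3) by (cases "t \<in> A"; cases "t \<in> B") (auto simp: e_def plus_fun_def)
      qed
      then show ?thesis
        using L(1) e_V[OF that(1)] e_V[OF that(2)] unfolding \<nu>_def linear_functional_on_def by metis
    qed
    moreover have "(LINT t:B|m. - support_fun (- y) (\<Gamma> t)) \<le> \<nu> y B" if "B \<in> sets m" for B
      using \<nu>_upper[OF that, of "- y"] \<nu>_minus[OF that, of y] by (simp add: set_lebesgue_integral_def)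
    ultimately show ?thesis
      using additive_between_integrals_has_density[OF m, of "\<lambda>t. - support_fun (- y) (\<Gamma> t)"
          "\<lambda>t. support_fun y (\<Gamma> t)" "\<nu> y"] si \<nu>_upper
      unfolding scalarly_integrable_def by (metis integrable_minus)
  qed
  then obtain T where T: "\<And>y. integrable m (T y)"
    and \<nu>_T: "\<And>y B. B \<in> sets m \<Longrightarrow> \<nu> y B = (LINT t:B|m. T y t)"
    by metis
  show thesis
  proof
    show "integrable m (T y)" for y by (rule T)
    show "(\<integral>t. T y t \<partial>m) = \<psi> y" for y
    proof -
      have "L (e (space m) y) = \<psi> y" by (intro L(3)) blast
      then show ?thesis
        using \<nu>_T[of "space m" y] T by (simp add: \<nu>_def set_integral_space)
    qed
    fix F :: "nat set" and l y assume F: "finite F"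
    show "AE t in m. (\<Sum>i\<in>F. l i * T (y i) t) \<le> support_fun (\<Sum>i\<in>F. l i *\<^sub>R y i) (\<Gamma> t)"
    proof (rule AE_le_from_set_integrals)
      show "integrable m (\<lambda>t. \<Sum>i\<in>F. l i * T (y i) t)"
        using T by simp
      show "integrable m (\<lambda>t. support_fun (\<Sum>i\<in>F. l i *\<^sub>R y i) (\<Gamma> t))"
        using si by (simp add: scalarly_integrable_def)
      fix B assume B: "B \<in> sets m"
      have "(LINT t:B|m. \<Sum>i\<in>F. l i * T (y i) t) = (\<Sum>i\<in>F. l i * (LINT t:B|m. T (y i) t))"
      proof -
        have "(LINT t:B|m. \<Sum>i\<in>F. l i * T (y i) t) = (\<integral>t. (\<Sum>i\<in>F. l i * (indicator B t *\<^sub>R T (y i) t)) \<partial>m)"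
          unfolding set_lebesgue_integral_def
          by (simp add: sum_distrib_left mult.left_commute)
        also have "\<dots> = (\<Sum>i\<in>F. \<integral>t. l i * (indicator B t *\<^sub>R T (y i) t) \<partial>m)"
          using integrable_mult_indicator[OF B T]
          by (intro Bochner_Integration.integral_sum integrable_mult_right) auto
        finally show ?thesis
          by (simp add: set_lebesgue_integral_def)
      qed
      also have "\<dots> = \<nu> (\<Sum>i\<in>F. l i *\<^sub>R y i) B"
        unfolding \<nu>_linear[OF B F] by (simp only: \<nu>_T[OF B])
      also have "\<dots> \<le> (LINT t:B|m. support_fun (\<Sum>i\<in>F. l i *\<^sub>R y i) (\<Gamma> t))"
        by (rule \<nu>_upper[OF B])
      finally show "(LINT t:B|m. \<Sum>i\<in>F. l i * T (y i) t)
          \<le> (LINT t:B|m. support_fun (\<Sum>i\<in>F. l i *\<^sub>R y i) (\<Gamma> t))" .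
    qed
  qed
qed

text \<open>
  For countably many functionals, the exceptional sets of all rational combinations can be
  discarded together, and the moment lemma realises the densities as the values of the functionals at
  a single point of \<open>\<Gamma> t\<close>.
\<close>
lemma densities_selected_AE:
  fixes \<Gamma> :: "'w \<Rightarrow> 'x::real_normed_vector set" and T :: "('x \<Rightarrow>\<^sub>L real) \<Rightarrow> 'w \<Rightarrow> real"
    and z :: "nat \<Rightarrow> 'x \<Rightarrow>\<^sub>L real"
  assumes \<Gamma>: "\<Gamma> \<in> space m \<rightarrow> cwk"
    and T: "\<And>F l y. finite (F :: nat set) \<Longrightarrow>
      AE t in m. (\<Sum>i\<in>F. l i * T (y i) t) \<le> support_fun (\<Sum>i\<in>F. l i *\<^sub>R y i) (\<Gamma> t)"
  shows "AE t in m. \<exists>x\<in>\<Gamma> t. \<forall>k. blinfun_apply (z k) x = T (z k) t"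
proof -
  have "AE t in m. \<forall>q :: rat list. (\<Sum>i<length q. of_rat (q ! i) * T (z i) t)
      \<le> support_fun (\<Sum>i<length q. of_rat (q ! i) *\<^sub>R z i) (\<Gamma> t)"
    by (subst AE_all_countable) (intro allI T finite_lessThan)
  then show ?thesis
    using AE_space
  proof eventually_elim
    case (elim t)
    then have "\<Gamma> t \<in> cwk" using \<Gamma> by auto
    then show ?case
      using elim(1) by (intro cwk_rational_moments) auto
  qed
qed

section \<open>Sequences of functionals tending to zero on the approximating sets\<close>

lemma integral_ge_on_convex_hull:
  fixes T :: "'y::real_vector \<Rightarrow> 'w \<Rightarrow> real"
  assumes lin: "\<And>t. linear (\<lambda>y. T y t)"
    and S: "\<And>y. y \<in> S \<Longrightarrow> integrable m (T y) \<and> c \<le> (\<integral>t. T y t \<partial>m)"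
    and y: "y \<in> convex hull S"
  shows "c \<le> (\<integral>t. T y t \<partial>m)"
proof -
  let ?H = "{y. integrable m (T y) \<and> c \<le> (\<integral>t. T y t \<partial>m)}"
  have "convex ?H"
    unfolding convex_def
  proof (intro ballI allI impI)
    fix a b and u v :: real
    assume ab: "a \<in> ?H" "b \<in> ?H" and uv: "0 \<le> u" "0 \<le> v" "u + v = 1"
    have eq: "T (u *\<^sub>R a + v *\<^sub>R b) = (\<lambda>t. u * T a t + v * T b t)"
      by (simp add: fun_eq_iff linear_add[OF lin] linear_cmul[OF lin])
    have "c = u * c + v * c"
      using uv by (simp flip: distrib_right)
    also have "\<dots> \<le> u * (\<integral>t. T a t \<partial>m) + v * (\<integral>t. T b t \<partial>m)"
      using ab uv by (intro add_mono mult_left_mono) auto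
    finally show "u *\<^sub>R a + v *\<^sub>R b \<in> ?H"
      using ab unfolding eq mem_Collect_eq by simp
  qed
  then have "convex hull S \<subseteq> ?H"
    using S by (intro hull_minimal) auto
  with y show ?thesis by auto
qed

definition scalarly_ac_integral :: "'w measure \<Rightarrow> ('w \<Rightarrow> 'x::real_normed_vector set) \<Rightarrow> bool" where
  "scalarly_ac_integral m \<Gamma> \<longleftrightarrow> (\<forall>\<epsilon>>0. \<exists>\<delta>>0. \<forall>y E. norm y \<le> 1 \<longrightarrow> E \<in> sets m \<longrightarrow> measure m E < \<delta> \<longrightarrow>
     (LINT t:E|m. \<bar>support_fun y (\<Gamma> t)\<bar>) \<le> \<epsilon>)"

text \<open>
  The core of the argument. Suppose that \<open>\<psi> (z k) \<ge> \<epsilon>\<close> for all \<open>k\<close>. A selection \<open>\<xi>\<close> of \<open>\<Gamma>\<close> represents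
  all the \<open>\<psi> (z k)\<close> as integrals of \<open>z k (\<xi> t)\<close>, and on a large set \<open>E R\<close> these integrands are uniformly
  bounded, because \<open>norm (\<xi> t)\<close> bounds the whole sequence. Convex combinations \<open>y k\<close> of the tails
  then converge at almost every \<open>\<xi> t\<close>; let \<open>w\<close> be a limit functional. It vanishes on every \<open>C n\<close>, so the
  support functions of \<open>\<Gamma> t\<close> at \<open>w\<close> and \<open>- w\<close> both have integral zero. Their sum is nonnegative,
  hence zero almost everywhere: \<open>w\<close> is constant on \<open>\<Gamma> t\<close>, and \<open>w (\<xi> t)\<close> is the support function of
  \<open>\<Gamma> t\<close> at \<open>w\<close>. Up to errors of size \<open>\<epsilon> / 3\<close> from the complement of \<open>E R\<close>, its integral is
  therefore both at least \<open>\<epsilon>\<close> and equal to zero.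
\<close>
lemma no_null_sequence_bounded_below:
  fixes \<Gamma> :: "'w \<Rightarrow> 'x::real_normed_vector set" and \<psi> :: "('x \<Rightarrow>\<^sub>L real) \<Rightarrow> real"
    and z :: "nat \<Rightarrow> 'x \<Rightarrow>\<^sub>L real"
  assumes m: "finite_measure m" and \<Gamma>: "\<Gamma> \<in> space m \<rightarrow> cwk" and si: "scalarly_integrable m \<Gamma>"
    and uac: "scalarly_ac_integral m \<Gamma>"
    and C: "\<And>n::nat. C n \<in> cwk"
    and lim: "\<And>y. (\<lambda>n. support_fun y (C n)) \<longlonglongrightarrow> (\<integral>t. support_fun y (\<Gamma> t) \<partial>m)"
    and \<psi>: "linear \<psi>" and le: "\<And>y. \<psi> y \<le> (\<integral>t. support_fun y (\<Gamma> t) \<partial>m)"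
    and z: "\<And>k. norm (z k) \<le> 1" and null: "\<And>n x. x \<in> C n \<Longrightarrow> (\<lambda>k. z k x) \<longlonglongrightarrow> 0"
    and \<epsilon>: "0 < \<epsilon>"
  shows "\<exists>k. \<psi> (z k) < \<epsilon>"
proof (rule ccontr)
  assume "\<not> (\<exists>k. \<psi> (z k) < \<epsilon>)"
  then have \<psi>_z: "\<epsilon> \<le> \<psi> (z k)" for k by (auto simp: not_less)
  interpret finite_measure m by fact
  have cwk: "\<Gamma> t \<in> cwk" if "t \<in> space m" for t using \<Gamma> that by auto
  have s_int: "integrable m (\<lambda>t. support_fun y (\<Gamma> t))" for y
    using si by (simp add: scalarly_integrable_def)
  define \<eta> where "\<eta> = \<epsilon> / 3"
  have \<eta>: "\<eta> > 0" using \<epsilon> by (simp add: \<eta>_def)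
  obtain \<delta> where \<delta>: "\<delta> > 0" and small: "\<And>y E. norm y \<le> 1 \<Longrightarrow> E \<in> sets m \<Longrightarrow> measure m E < \<delta> \<Longrightarrow>
      (LINT t:E|m. \<bar>support_fun y (\<Gamma> t)\<bar>) \<le> \<eta>"
    using uac \<eta> unfolding scalarly_ac_integral_def by blast
  obtain T :: "('x \<Rightarrow>\<^sub>L real) \<Rightarrow> 'w \<Rightarrow> real" where T_int: "\<And>y. integrable m (T y)"
    and T_\<psi>: "\<And>y. (\<integral>t. T y t \<partial>m) = \<psi> y"
    and T_le: "\<And>F l y. finite (F :: nat set) \<Longrightarrow>
      AE t in m. (\<Sum>i\<in>F. l i * T (y i) t) \<le> support_fun (\<Sum>i\<in>F. l i *\<^sub>R y i) (\<Gamma> t)"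
    using dominated_functional_has_densities[OF m \<Gamma> si \<psi> le] by blast
  have T_meas [measurable]: "T y \<in> borel_measurable m" for y
    using T_int by auto
  have sel: "AE t in m. \<exists>x\<in>\<Gamma> t. \<forall>k. blinfun_apply (z k) x = T (z k) t"
    by (rule densities_selected_AE[OF \<Gamma> T_le])
  then obtain N where N: "N \<in> null_sets m"
    and good: "\<And>t. t \<in> space m - N \<Longrightarrow> \<exists>x\<in>\<Gamma> t. \<forall>k. blinfun_apply (z k) x = T (z k) t"
    by (auto elim!: AE_E3)
  define E where "E R = {t \<in> space m - N. \<forall>k. \<bar>T (z k) t\<bar> \<le> real R}" for R :: nat
  have N_sets [measurable]: "N \<in> sets m" using N by auto
  have "E R = {t \<in> space m. \<forall>k. \<bar>T (z k) t\<bar> \<le> real R} - N" for R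
    by (auto simp: E_def)
  moreover have "{t \<in> space m. \<forall>k. \<bar>T (z k) t\<bar> \<le> real R} \<in> sets m" for R
    by measurable
  ultimately have E_sets: "E R \<in> sets m" for R
    using N_sets by auto
  let ?A = "\<lambda>R. (space m - N) - E R"
  have "(\<lambda>R. measure m (?A R)) \<longlonglongrightarrow> measure m (\<Inter>R. ?A R)"
  proof (rule finite_Lim_measure_decseq)
    show "range ?A \<subseteq> sets m"
      using E_sets N_sets by auto
    show "decseq ?A"
    proof -
      have "E i \<subseteq> E j" if "i \<le> j" for i j
        unfolding E_def using that by (auto intro: order_trans[OF _ of_nat_mono])
      then show ?thesis
        unfolding decseq_def by blast
    qed
  qed
  moreover have "(\<Inter>R. ?A R) = {}"
  proof (rule equals0I)
    fix t assume t: "t \<in> (\<Inter>R. ?A R)"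
    then have "t \<in> space m - N" by blast
    then obtain x where x: "\<And>k. blinfun_apply (z k) x = T (z k) t"
      using good by blast
    obtain R :: nat where R: "norm x \<le> real R"
      using real_arch_simple by blast
    have "\<bar>T (z k) t\<bar> \<le> real R" for k
      using norm_blinfun[of "z k" x] mult_right_mono[OF z[of k], of "norm x"] R x[of k] by simp
    with \<open>t \<in> space m - N\<close> have "t \<in> E R" by (simp add: E_def)
    with t show False by blast
  qed
  ultimately have "(\<lambda>R. measure m (?A R)) \<longlonglongrightarrow> 0"
    by (simp only: measure_empty)
  then have "\<forall>\<^sub>F R in sequentially. measure m (?A R) < \<delta>"
    using \<delta> by (rule order_tendstoD)
  then obtain R where R: "measure m (?A R) < \<delta>"
    by (auto simp: eventually_sequentially)
  define F where "F = space m - E R"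
  have F_sets: "F \<in> sets m" using E_sets by (auto simp: F_def)
  have F_small: "measure m F < \<delta>"
  proof -
    have "measure m F \<le> measure m (?A R \<union> N)"
      using E_sets N_sets by (intro finite_measure_mono) (auto simp: F_def)
    also have "\<dots> \<le> measure m (?A R) + measure m N"
      using E_sets N_sets by (intro measure_Un_le) auto
    also have "measure m N = 0"
      using N by (simp add: null_sets_def measure_def)
    finally show ?thesis using R by simp
  qed
  have split: "(\<integral>t. f t \<partial>m) = (LINT t:E R|m. f t) + (LINT t:F|m. f t)" if "integrable m f" for f :: "'w \<Rightarrow> real"
  proof -
    have "(LINT t:E R \<union> F|m. f t) = (LINT t:E R|m. f t) + (LINT t:F|m. f t)"
      using integrable_mult_indicator[OF E_sets that] integrable_mult_indicator[OF F_sets that]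
      by (intro set_integral_Un) (auto simp: F_def set_integrable_def)
    moreover have "E R \<union> F = space m"
      by (auto simp: F_def E_def)
    ultimately show ?thesis
      using set_integral_space[OF that] by simp
  qed
  \<comment> \<open>The value \<open>0\<close> off \<open>E R\<close> makes \<open>z k (\<xi> t)\<close> measurable and bounded on the whole space.\<close>
  define \<xi> where "\<xi> t = (if t \<in> E R then SOME x. x \<in> \<Gamma> t \<and> (\<forall>k. blinfun_apply (z k) x = T (z k) t) else 0)" for t
  have \<xi>: "\<xi> t \<in> \<Gamma> t" "blinfun_apply (z k) (\<xi> t) = T (z k) t" if "t \<in> E R" for t k
  proof -
    have "\<exists>x. x \<in> \<Gamma> t \<and> (\<forall>k. blinfun_apply (z k) x = T (z k) t)"
      using good[of t] that by (auto simp: E_def)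
    from someI_ex[OF this] that show "\<xi> t \<in> \<Gamma> t" "blinfun_apply (z k) (\<xi> t) = T (z k) t"
      by (simp_all add: \<xi>_def)
  qed
  define P where "P y t = blinfun_apply y (\<xi> t)" for y :: "'x \<Rightarrow>\<^sub>L real" and t
  have P_lin: "linear (\<lambda>y. P y t)" for t
    by (auto simp: P_def blinfun.add_left blinfun.scaleR_left intro!: linearI)
  have P_z: "P (z k) = (\<lambda>t. indicator (E R) t *\<^sub>R T (z k) t)" for k
    using \<xi>(2) by (auto simp: P_def \<xi>_def indicator_def fun_eq_iff)
  have P_z_int: "integrable m (P (z k))" for k
    unfolding P_z by (intro integrable_mult_indicator E_sets T_int)
  have P_z_bound: "\<bar>P (z k) t\<bar> \<le> real R" for k t
    unfolding P_z by (auto simp: indicator_def E_def)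
  have P_z_integral: "\<epsilon> - \<eta> \<le> (\<integral>t. P (z k) t \<partial>m)" for k
  proof -
    have "(LINT t:F|m. T (z k) t) \<le> (LINT t:F|m. \<bar>support_fun (z k) (\<Gamma> t)\<bar>)"
      unfolding set_lebesgue_integral_def
    proof (rule integral_mono_AE)
      show "AE t in m. indicator F t *\<^sub>R T (z k) t \<le> indicator F t *\<^sub>R \<bar>support_fun (z k) (\<Gamma> t)\<bar>"
        using sel AE_space
      proof eventually_elim
        case (elim t)
        then have "T (z k) t \<le> support_fun (z k) (\<Gamma> t)"
          using support_fun_upper[OF cwk] by metis
        then have "T (z k) t \<le> \<bar>support_fun (z k) (\<Gamma> t)\<bar>"
          by linarith
        then show ?case by (simp add: indicator_def)
      qed
    qed (intro integrable_mult_indicator F_sets T_int integrable_abs s_int)+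
    also have "\<dots> \<le> \<eta>"
      by (rule small[OF z F_sets F_small])
    finally have "\<epsilon> - \<eta> \<le> (LINT t:E R|m. T (z k) t)"
      using split[OF T_int, of "z k"] \<psi>_z[of k] by (simp add: T_\<psi>)
    then show ?thesis
      unfolding P_z set_lebesgue_integral_def by simp
  qed
  obtain y where y: "\<And>k. y k \<in> convex hull (z ` {k..})"
    and P_y_meas: "\<And>k. P (y k) \<in> borel_measurable m" and P_y_bound: "\<And>k t. \<bar>P (y k) t\<bar> \<le> real R"
    and conv: "AE t in m. convergent (\<lambda>k. P (y k) t)"
    using convex_tails_converge_AE[of m P z "real R", OF m P_lin borel_measurable_integrable[OF P_z_int] P_z_bound]
    by blast
  have P_y_integral: "\<epsilon> - \<eta> \<le> (\<integral>t. P (y k) t \<partial>m)" for k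
    using P_z_int P_z_integral by (intro integral_ge_on_convex_hull[OF P_lin _ y[of k]]) auto
  have y_norm: "norm (y k) \<le> 1" for k
  proof -
    have "convex hull (z ` {k..}) \<subseteq> cball 0 1"
      using z by (intro hull_minimal) auto
    with y[of k] show ?thesis by auto
  qed
  obtain w :: "'x \<Rightarrow>\<^sub>L real" where w: "norm w \<le> 1" "\<And>x c. (\<lambda>k. y k x) \<longlonglongrightarrow> c \<Longrightarrow> w x = c"
    using norm_extension_of_pointwise_limits[of y] y_norm by blast
  have w_C: "w x = 0" if x: "x \<in> C n" for n x
  proof (rule w(2), rule LIMSEQ_I)
    fix r :: real assume r: "0 < r"
    have "\<forall>\<^sub>F k in sequentially. \<bar>z k x\<bar> < r / 2"
      using tendsto_rabs_zero[OF null[OF x]] r by (intro order_tendstoD) auto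
    then obtain K where K: "\<And>k. k \<ge> K \<Longrightarrow> \<bar>z k x\<bar> < r / 2"
      by (auto simp: eventually_sequentially)
    have "\<bar>y k x\<bar> \<le> r / 2" if k: "k \<ge> K" for k
    proof -
      have "convex {f. blinfun_apply f x \<in> {- r / 2..r / 2}}"
      proof -
        have "convex ((\<lambda>f. blinfun_apply f x) -` {- r / 2..r / 2})"
          by (intro convex_linear_vimage convex_closed_interval linearI)
             (auto simp: blinfun.add_left blinfun.scaleR_left)
        then show ?thesis by (simp add: vimage_def)
      qed
      moreover have "z ` {k..} \<subseteq> {f. blinfun_apply f x \<in> {- r / 2..r / 2}}"
      proof (intro image_subsetI CollectI)
        fix j assume "j \<in> {k..}"
        then have "\<bar>z j x\<bar> < r / 2" using k by (intro K) simp
        then show "blinfun_apply (z j) x \<in> {- r / 2..r / 2}" by auto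
      qed
      ultimately have "convex hull (z ` {k..}) \<subseteq> {f. blinfun_apply f x \<in> {- r / 2..r / 2}}"
        by (rule hull_minimal[rotated])
      then have "blinfun_apply (y k) x \<in> {- r / 2..r / 2}"
        using y[of k] by blast
      then show ?thesis by auto
    qed
    then show "\<exists>K. \<forall>k\<ge>K. norm (y k x - 0) < r"
      using r by (intro exI[of _ K]) (smt (verit) field_sum_of_halves real_norm_def)
  qed
  have C_zero: "support_fun v (C n) = 0" if v: "\<And>x. x \<in> C n \<Longrightarrow> blinfun_apply v x = 0" for v n
  proof -
    obtain x where "x \<in> C n" using cwk_nonempty[OF C] by blast
    then have "0 \<le> support_fun v (C n)"
      using support_fun_upper[OF C, of x n v] v by simp
    moreover have "support_fun v (C n) \<le> 0"
      using v by (intro support_fun_least[OF C]) simp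
    ultimately show ?thesis by simp
  qed
  have int_w: "(\<integral>t. support_fun w (\<Gamma> t) \<partial>m) = 0" "(\<integral>t. support_fun (- w) (\<Gamma> t) \<partial>m) = 0"
    using lim[of w] lim[of "- w"] C_zero w_C
    by (simp_all add: blinfun.minus_left LIMSEQ_const_iff)
  have flat: "AE t in m. support_fun w (\<Gamma> t) + support_fun (- w) (\<Gamma> t) = 0"
  proof (subst integral_nonneg_eq_0_iff_AE[symmetric])
    show "AE t in m. 0 \<le> support_fun w (\<Gamma> t) + support_fun (- w) (\<Gamma> t)"
    proof (rule AE_I2)
      fix t assume "t \<in> space m"
      from support_fun_add[OF cwk[OF this], of w "- w"] support_fun_zero[OF cwk[OF this]]
      show "0 \<le> support_fun w (\<Gamma> t) + support_fun (- w) (\<Gamma> t)" by simp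
    qed
    show "(\<integral>t. support_fun w (\<Gamma> t) + support_fun (- w) (\<Gamma> t) \<partial>m) = 0"
      using s_int int_w by simp
  qed (use s_int in simp)
  have P_w: "AE t in m. (\<lambda>k. P (y k) t) \<longlonglongrightarrow> indicator (E R) t *\<^sub>R support_fun w (\<Gamma> t)"
    using conv flat AE_space
  proof eventually_elim
    case (elim t)
    then obtain c where c: "(\<lambda>k. P (y k) t) \<longlonglongrightarrow> c" by (auto simp: convergent_def)
    then have "w (\<xi> t) = c" unfolding P_def by (rule w(2))
    moreover have "w (\<xi> t) = indicator (E R) t *\<^sub>R support_fun w (\<Gamma> t)"
    proof (cases "t \<in> E R")
      case True
      then show ?thesis
        using support_fun_upper[OF cwk[OF elim(3)] \<xi>(1)[OF True], of w]
          support_fun_lower[OF cwk[OF elim(3)] \<xi>(1)[OF True], of w] elim(2) by simp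
    next
      case False
      then show ?thesis by (simp add: \<xi>_def)
    qed
    ultimately show ?case using c by simp
  qed
  have "(\<lambda>k. \<integral>t. P (y k) t \<partial>m) \<longlonglongrightarrow> (\<integral>t. indicator (E R) t *\<^sub>R support_fun w (\<Gamma> t) \<partial>m)"
  proof (rule integral_dominated_convergence[OF _ P_y_meas _ P_w])
    show "integrable m (\<lambda>t. real R)" by simp
    show "(\<lambda>t. indicator (E R) t *\<^sub>R support_fun w (\<Gamma> t)) \<in> borel_measurable m"
      using integrable_mult_indicator[OF E_sets s_int] by blast
  qed (use P_y_bound in auto)
  then have "\<epsilon> - \<eta> \<le> (LINT t:E R|m. support_fun w (\<Gamma> t))"
    unfolding set_lebesgue_integral_def by (rule LIMSEQ_le_const) (use P_y_integral in blast)
  moreover have "- (LINT t:F|m. support_fun w (\<Gamma> t)) \<le> \<eta>"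
  proof -
    have "- (LINT t:F|m. support_fun w (\<Gamma> t)) \<le> norm (LINT t:F|m. support_fun w (\<Gamma> t))"
      by simp
    also have "\<dots> \<le> (LINT t:F|m. norm (support_fun w (\<Gamma> t)))"
      using integrable_mult_indicator[OF F_sets s_int] by (intro set_integral_norm_bound) (simp add: set_integrable_def)
    also have "\<dots> \<le> \<eta>"
      using small[OF w(1) F_sets F_small] by simp
    finally show ?thesis .
  qed
  ultimately show False
    using split[OF s_int, of w] int_w(1) \<epsilon> by (simp add: \<eta>_def)
qed

section \<open>Sublinear functionals that dominate only evaluations\<close>

text \<open>
  For sublinear functionals on the dual this is continuity in the Mackey topology, expressed
  through the linear functionals below them.
\<close>
definition dominates_evaluations_only :: "(('x::real_normed_vector \<Rightarrow>\<^sub>L real) \<Rightarrow> real) \<Rightarrow> bool" where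
  "dominates_evaluations_only p \<longleftrightarrow> sublinear_on UNIV p \<and>
     (\<forall>L. linear L \<longrightarrow> (\<forall>y. L y \<le> p y) \<longrightarrow> (\<exists>x. \<forall>y. L y = blinfun_apply y x))"

lemma dominates_evaluations_only_support_fun:
  "C \<in> cwk \<Longrightarrow> dominates_evaluations_only (\<lambda>y. support_fun y C)"
  unfolding dominates_evaluations_only_def
  using sublinear_on_support_fun dominated_by_support_fun_is_evaluation by blast

lemma dominates_evaluations_only_reflect:
  assumes "dominates_evaluations_only p"
  shows "dominates_evaluations_only (\<lambda>y. p (- y))"
  unfolding dominates_evaluations_only_def
proof (intro conjI allI impI)
  show "sublinear_on UNIV (\<lambda>y. p (- y))"
    using assms unfolding dominates_evaluations_only_def sublinear_on_def
    by (metis (no_types, lifting) UNIV_I minus_add_distrib scaleR_minus_right)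
  fix L assume L: "linear L" "\<forall>y. L y \<le> p (- y)"
  have "linear (\<lambda>y. L (- y))"
    using linear_compose[OF linear_uminus L(1)] by (simp add: o_def)
  moreover have "\<forall>y. L (- y) \<le> p y"
    using L(2) by (metis minus_minus)
  ultimately obtain x where "\<forall>y. L (- y) = blinfun_apply y x"
    using assms unfolding dominates_evaluations_only_def by blast
  then have "\<forall>y. L y = blinfun_apply y (- x)"
    by (metis blinfun.minus_left blinfun.minus_right minus_minus)
  then show "\<exists>x. \<forall>y. L y = blinfun_apply y x" by blast
qed

text \<open>
  A functional below the sum splits into two functionals below the summands, by the sandwich
  theorem.
\<close>
lemma dominates_evaluations_only_add:
  assumes p: "dominates_evaluations_only p" and q: "dominates_evaluations_only q"
  shows "dominates_evaluations_only (\<lambda>y. p y + q y)"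
  unfolding dominates_evaluations_only_def
proof (intro conjI allI impI)
  have sub: "sublinear_on UNIV p" "sublinear_on UNIV q"
    using p q by (auto simp: dominates_evaluations_only_def)
  then show "sublinear_on UNIV (\<lambda>y. p y + q y)"
    by (auto simp: sublinear_on_def distrib_left) (smt (verit))
  fix L assume L: "linear L" "\<forall>y. L y \<le> p y + q y"
  obtain L' L'' where split: "linear L'" "linear L''" "\<And>x. L' x \<le> p x" "\<And>x. L'' x \<le> q x"
    "\<And>x. L x = L' x + L'' x"
    using hahn_banach_sandwich[OF sub L(1)] L(2) by blast
  obtain a b where "\<forall>y. L' y = blinfun_apply y a" "\<forall>y. L'' y = blinfun_apply y b"
    using p q split unfolding dominates_evaluations_only_def by blast
  then have "\<forall>y. L y = blinfun_apply y (a + b)"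
    by (simp add: split(5) blinfun.add_right)
  then show "\<exists>x. \<forall>y. L y = blinfun_apply y x" by blast
qed

lemma dominates_evaluations_only_zero: "dominates_evaluations_only (\<lambda>y. 0)"
  unfolding dominates_evaluations_only_def
proof (intro conjI allI impI)
  show "sublinear_on UNIV (\<lambda>y :: 'a \<Rightarrow>\<^sub>L real. 0)" by (simp add: sublinear_on_def)
  fix L :: "('a \<Rightarrow>\<^sub>L real) \<Rightarrow> real" assume L: "linear L" "\<forall>y. L y \<le> 0"
  have "L y = 0" for y
    using L(2)[rule_format, of y] L(2)[rule_format, of "- y"] linear_neg[OF L(1), of y] by simp
  then show "\<exists>x. \<forall>y. L y = blinfun_apply y x"
    by (intro exI[of _ 0]) simp
qed

lemma dominates_evaluations_only_scale:
  assumes p: "dominates_evaluations_only p"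
  shows "dominates_evaluations_only (\<lambda>y. real n * p y)"
proof (induction n)
  case 0
  show ?case using dominates_evaluations_only_zero by simp
next
  case (Suc n)
  then show ?case
    using dominates_evaluations_only_add[OF p Suc] by (simp add: algebra_simps)
qed

text \<open>
  A functional below \<open>\<bar>blinfun_apply y x\<bar>\<close> vanishes wherever \<open>y x = 0\<close>, so it is a multiple of the
  evaluation at \<open>x\<close>.
\<close>
lemma dominates_evaluations_only_abs:
  fixes x :: "'x::real_normed_vector"
  shows "dominates_evaluations_only (\<lambda>y. \<bar>blinfun_apply y x\<bar>)"
  unfolding dominates_evaluations_only_def
proof (intro conjI allI impI)
  show "sublinear_on UNIV (\<lambda>y. \<bar>blinfun_apply y x\<bar>)"
    by (auto simp: sublinear_on_def blinfun.add_left blinfun.scaleR_left abs_mult abs_triangle_ineq)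
  fix L :: "('x \<Rightarrow>\<^sub>L real) \<Rightarrow> real" assume L: "linear L" "\<forall>y. L y \<le> \<bar>blinfun_apply y x\<bar>"
  have ker: "L y = 0" if "blinfun_apply y x = 0" for y
    using L(2)[rule_format, of y] L(2)[rule_format, of "- y"] linear_neg[OF L(1), of y] that
    by (simp add: blinfun.minus_left)
  show "\<exists>a. \<forall>y. L y = blinfun_apply y a"
  proof (cases "\<exists>v :: 'x \<Rightarrow>\<^sub>L real. blinfun_apply v x \<noteq> 0")
    case False
    then show ?thesis using ker by (intro exI[of _ 0]) simp
  next
    case True
    then obtain v :: "'x \<Rightarrow>\<^sub>L real" where v: "blinfun_apply v x \<noteq> 0" by blast
    have "L y = blinfun_apply y ((L v / blinfun_apply v x) *\<^sub>R x)" for y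
    proof -
      let ?c = "blinfun_apply y x / blinfun_apply v x"
      have "L (y - ?c *\<^sub>R v) = 0"
        using v by (intro ker) (simp add: blinfun.diff_left blinfun.scaleR_left)
      then show ?thesis
        using v by (simp add: linear_diff[OF L(1)] linear_cmul[OF L(1)] blinfun.scaleR_right)
    qed
    then show ?thesis by blast
  qed
qed

text \<open>
  Completeness of the space: evaluations that are uniformly close on the dual unit ball belong to
  close points, because every vector is normed by a functional in that ball.
\<close>
lemma norm_limit_of_evaluations:
  fixes \<psi> :: "('x::banach \<Rightarrow>\<^sub>L real) \<Rightarrow> real"
  assumes approx: "\<And>e::real. e > 0 \<Longrightarrow> \<exists>x. \<forall>y. \<bar>\<psi> y - blinfun_apply y x\<bar> \<le> e * norm y"
  shows "\<exists>x. \<forall>y. \<psi> y = blinfun_apply y x"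
proof -
  have "\<exists>x. \<forall>y. \<bar>\<psi> y - blinfun_apply y x\<bar> \<le> inverse (Suc n) * norm y" for n :: nat
    by (rule approx) simp
  then obtain x where x: "\<And>n y. \<bar>\<psi> y - blinfun_apply y (x n)\<bar> \<le> inverse (real (Suc n)) * norm y"
    by metis
  have dist: "norm (x i - x j) \<le> inverse (real (Suc i)) + inverse (real (Suc j))" for i j
  proof -
    obtain y :: "'x \<Rightarrow>\<^sub>L real" where y: "norm y \<le> 1" "y (x i - x j) = norm (x i - x j)"
      using norming_functional by blast
    have "inverse (real (Suc n)) * norm y \<le> inverse (real (Suc n))" for n
      using y(1) by (intro mult_left_le) auto
    then have "\<bar>\<psi> y - blinfun_apply y (x n)\<bar> \<le> inverse (real (Suc n))" for n
      using x[of y n] order_trans by blast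
    from this[of i] this[of j] y(2) show ?thesis
      by (simp add: blinfun.diff_right del: of_nat_Suc)
  qed
  have "Cauchy x"
  proof (rule CauchyI)
    fix e :: real assume e: "0 < e"
    obtain N where N: "inverse (real (Suc N)) < e / 2"
      using reals_Archimedean[of "e / 2"] e by auto
    have "norm (x i - x j) < e" if "i \<ge> N" "j \<ge> N" for i j
    proof -
      have "inverse (real (Suc i)) \<le> inverse (real (Suc N))" "inverse (real (Suc j)) \<le> inverse (real (Suc N))"
        using that by (auto intro!: le_imp_inverse_le)
      with N dist[of i j] show ?thesis by linarith
    qed
    then show "\<exists>N. \<forall>i\<ge>N. \<forall>j\<ge>N. norm (x i - x j) < e" by blast
  qed
  then obtain a where a: "x \<longlonglongrightarrow> a"
    using Cauchy_convergent_iff convergent_def by blast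
  have "\<psi> y = blinfun_apply y a" for y
  proof -
    have "(\<lambda>n. \<psi> y - blinfun_apply y (x n)) \<longlonglongrightarrow> 0"
    proof (rule Lim_null_comparison)
      show "\<forall>\<^sub>F n in sequentially. norm (\<psi> y - blinfun_apply y (x n)) \<le> inverse (real (Suc n)) * norm y"
        using x by simp
      show "(\<lambda>n. inverse (real (Suc n)) * norm y) \<longlonglongrightarrow> 0"
        using tendsto_mult_left_zero[OF LIMSEQ_inverse_real_of_nat] .
    qed
    moreover have "(\<lambda>n. \<psi> y - blinfun_apply y (x n)) \<longlonglongrightarrow> \<psi> y - blinfun_apply y a"
      by (intro tendsto_intros a)
    ultimately show ?thesis
      using LIMSEQ_unique by fastforce
  qed
  then show ?thesis by blast
qed

section \<open>Limits of support functions\<close>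

text \<open>
  For each \<open>e\<close>, the functional \<open>\<psi>\<close> lies below \<open>N * q N + e * norm\<close> for some \<open>N\<close>, where \<open>q N\<close> measures the
  size of a functional on the first \<open>N\<close> sets. Otherwise the counterexamples, rescaled, would form
  a sequence in the unit ball that tends to zero on every \<open>C n\<close> while \<open>\<psi>\<close> stays away from zero. Given
  the bound, the sandwich theorem splits \<open>\<psi>\<close> into an evaluation and a functional of norm at most \<open>e\<close>.
\<close>
lemma functional_below_limit_is_evaluation:
  fixes \<Gamma> :: "'w \<Rightarrow> 'x::banach set" and \<psi> :: "('x \<Rightarrow>\<^sub>L real) \<Rightarrow> real"
  assumes m: "finite_measure m" and \<Gamma>: "\<Gamma> \<in> space m \<rightarrow> cwk" and si: "scalarly_integrable m \<Gamma>"
    and uac: "scalarly_ac_integral m \<Gamma>"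
    and C: "\<And>n::nat. C n \<in> cwk"
    and lim: "\<And>y. (\<lambda>n. support_fun y (C n)) \<longlonglongrightarrow> (\<integral>t. support_fun y (\<Gamma> t) \<partial>m)"
    and \<psi>: "linear \<psi>" and le: "\<And>y. \<psi> y \<le> (\<integral>t. support_fun y (\<Gamma> t) \<partial>m)"
  shows "\<exists>x. \<forall>y. \<psi> y = blinfun_apply y x"
proof (rule norm_limit_of_evaluations)
  fix e :: real assume e: "0 < e"
  obtain c where c: "\<And>n. c n \<in> C n"
    using cwk_nonempty[OF C] by metis
  \<comment> \<open>The width of \<open>C n\<close> in direction \<open>y\<close> controls \<open>y\<close> on \<open>C n\<close> only up to a constant; the value at the
    point \<open>c n\<close> controls the constant.\<close>
  define r where "r n y = support_fun y (C n) + support_fun (- y) (C n) + \<bar>blinfun_apply y (c n)\<bar>" for n y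
  define q where "q N y = (\<Sum>n<N. r n y)" for N y
  have r_good: "dominates_evaluations_only (r n)" for n
    unfolding r_def[abs_def]
    by (intro dominates_evaluations_only_add dominates_evaluations_only_abs C
        dominates_evaluations_only_support_fun dominates_evaluations_only_reflect[of "\<lambda>y. support_fun y (C n)"])
  have q_good: "dominates_evaluations_only (q N)" for N
    unfolding q_def[abs_def]
    by (induction N) (auto intro: dominates_evaluations_only_zero dominates_evaluations_only_add r_good)
  have width: "0 \<le> support_fun y (C n) + support_fun (- y) (C n)" for n y
    using support_fun_add[OF C, of y "- y" n] support_fun_zero[OF C, of n] by simp
  have r_nonneg: "0 \<le> r n y" for n y
    using width by (simp add: r_def)
  have q_scale: "q N (a *\<^sub>R y) = a * q N y" if "a \<ge> 0" for a N y
    using q_good[of N] that by (auto simp: dominates_evaluations_only_def sublinear_on_def)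
  have "\<exists>N. \<forall>y. \<psi> y \<le> real N * q N y + e * norm y"
  proof (rule ccontr)
    assume "\<not> ?thesis"
    then obtain v where v: "\<And>N. real N * q N (v N) + e * norm (v N) < \<psi> (v N)"
      by (metis not_le)
    have q_nonneg: "0 \<le> q N y" for N y
      unfolding q_def by (intro sum_nonneg r_nonneg)
    \<comment> \<open>Dividing by the larger of the norm and the value under \<open>\<psi>\<close> keeps \<open>\<psi> (z N) \<ge> min e 1\<close> and makes
      \<open>N * q N (z N) \<le> 1\<close>, without any bound for \<open>\<psi>\<close> on the unit ball.\<close>
    define a where "a N = max (norm (v N)) (\<psi> (v N))" for N
    define z where "z N = inverse (a N) *\<^sub>R v N" for N
    have \<psi>_pos: "0 < \<psi> (v N)" for N
    proof -
      have "0 \<le> real N * q N (v N) + e * norm (v N)"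
        using e q_nonneg by (intro add_nonneg_nonneg mult_nonneg_nonneg) auto
      with v[of N] show ?thesis by linarith
    qed
    then have a_pos: "0 < a N" for N
      unfolding a_def by (simp add: less_max_iff_disj)
    have z_norm: "norm (z N) \<le> 1" for N
      using a_pos[of N] by (simp add: z_def a_def field_simps)
    have \<psi>_z: "min e 1 \<le> \<psi> (z N)" for N
    proof (cases "norm (v N) \<le> \<psi> (v N)")
      case True
      then show ?thesis
        using a_pos[of N] by (simp add: z_def linear_cmul[OF \<psi>] a_def)
    next
      case False
      have "e * norm (v N) \<le> \<psi> (v N)"
        using v[of N] mult_nonneg_nonneg[OF of_nat_0_le_iff q_nonneg, of N N "v N"] by linarith
      with False show ?thesis
        using a_pos[of N] by (simp add: z_def linear_cmul[OF \<psi>] a_def field_simps min_le_iff_disj)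
    qed
    have q_z: "real N * q N (z N) \<le> 1" for N
    proof -
      have "real N * q N (v N) \<le> a N"
      proof -
        have "0 \<le> e * norm (v N)" using e by simp
        with v[of N] have "real N * q N (v N) \<le> \<psi> (v N)" by linarith
        then show ?thesis unfolding a_def by (rule max.coboundedI2)
      qed
      then show ?thesis
        using a_pos[of N] by (simp add: z_def q_scale field_simps)
    qed
    have "(\<lambda>N. z N x) \<longlonglongrightarrow> 0" if x: "x \<in> C n" for n x
    proof (rule Lim_null_comparison)
      have "norm (z N x) \<le> 2 * inverse (real N)" if N: "N > n" for N
      proof -
        have "r n (z N) \<le> q N (z N)"
          unfolding q_def using N r_nonneg by (intro member_le_sum) auto
        also have "\<dots> \<le> inverse (real N)"
          using q_z[of N] N by (simp add: field_simps)
        finally have small: "r n (z N) \<le> inverse (real N)" .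
        have bounds: "support_fun (z N) (C n) + support_fun (- z N) (C n) \<le> inverse (real N)"
          "\<bar>z N (c n)\<bar> \<le> inverse (real N)"
          using small width[of "z N" n] by (auto simp: r_def)
        have "z N x \<le> support_fun (z N) (C n)" "- support_fun (- z N) (C n) \<le> z N x"
          "z N (c n) \<le> support_fun (z N) (C n)" "- support_fun (- z N) (C n) \<le> z N (c n)"
          using support_fun_upper[OF C] support_fun_lower[OF C] x c by auto
        with bounds show ?thesis by (simp add: abs_le_iff)
      qed
      then show "\<forall>\<^sub>F N in sequentially. norm (z N x) \<le> 2 * inverse (real N)"
        using eventually_gt_at_top by (rule eventually_mono[rotated])
      show "(\<lambda>N. 2 * inverse (real N)) \<longlonglongrightarrow> 0"
        by (rule tendsto_mult_right_zero[OF lim_inverse_n])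
    qed
    then have "\<exists>k. \<psi> (z k) < min e 1"
      using e z_norm by (intro no_null_sequence_bounded_below[OF m \<Gamma> si uac C lim \<psi> le]) auto
    then show False
      using \<psi>_z by (meson not_le)
  qed
  then obtain N where N: "\<And>y. \<psi> y \<le> real N * q N y + e * norm y" by blast
  have good: "dominates_evaluations_only (\<lambda>y. real N * q N y)"
    by (rule dominates_evaluations_only_scale[OF q_good])
  then have sub: "sublinear_on UNIV (\<lambda>y. real N * q N y)"
    by (simp add: dominates_evaluations_only_def)
  have "sublinear_on UNIV (\<lambda>y :: 'x \<Rightarrow>\<^sub>L real. e * norm y)"
    using e by (auto simp: sublinear_on_def norm_triangle_ineq simp flip: distrib_left)
  from hahn_banach_sandwich[OF sub this \<psi> N] obtain L' L'' where L: "linear L'" "linear L''"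
    "\<And>y. L' y \<le> real N * q N y" "\<And>y. L'' y \<le> e * norm y" "\<And>y. \<psi> y = L' y + L'' y"
    by blast
  obtain x where x: "\<And>y. L' y = blinfun_apply y x"
    using good L(1,3) unfolding dominates_evaluations_only_def by blast
  have "\<bar>\<psi> y - blinfun_apply y x\<bar> \<le> e * norm y" for y
    using L(4)[of y] L(4)[of "- y"] linear_neg[OF L(2), of y] by (simp add: L(5) x)
  then show "\<exists>x. \<forall>y. \<bar>\<psi> y - blinfun_apply y x\<bar> \<le> e * norm y" by blast
qed

theorem limit_of_support_funs_is_support_fun:
  fixes \<Gamma> :: "'w \<Rightarrow> 'x::banach set"
  assumes m: "finite_measure m" and \<Gamma>: "\<Gamma> \<in> space m \<rightarrow> cwk" and si: "scalarly_integrable m \<Gamma>"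
    and uac: "scalarly_ac_integral m \<Gamma>"
    and C: "\<And>n::nat. C n \<in> cwk"
    and lim: "\<And>y. (\<lambda>n. support_fun y (C n)) \<longlonglongrightarrow> (\<integral>t. support_fun y (\<Gamma> t) \<partial>m)"
  shows "\<exists>K\<in>cwk. \<forall>y. support_fun y K = (\<integral>t. support_fun y (\<Gamma> t) \<partial>m)"
proof (rule cwk_of_sublinear)
  have s_int: "integrable m (\<lambda>t. support_fun y (\<Gamma> t))" for y
    using si by (simp add: scalarly_integrable_def)
  have cwk: "\<Gamma> t \<in> cwk" if "t \<in> space m" for t using \<Gamma> that by auto
  show "sublinear_on UNIV (\<lambda>y. \<integral>t. support_fun y (\<Gamma> t) \<partial>m)"
    unfolding sublinear_on_def
  proof (intro conjI ballI allI impI)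
    fix y z :: "'x \<Rightarrow>\<^sub>L real" and c :: real
    have "(\<integral>t. support_fun (y + z) (\<Gamma> t) \<partial>m) \<le> (\<integral>t. support_fun y (\<Gamma> t) + support_fun z (\<Gamma> t) \<partial>m)"
      using s_int by (intro integral_mono) (auto intro: support_fun_add[OF cwk])
    then show "(\<integral>t. support_fun (y + z) (\<Gamma> t) \<partial>m)
        \<le> (\<integral>t. support_fun y (\<Gamma> t) \<partial>m) + (\<integral>t. support_fun z (\<Gamma> t) \<partial>m)"
      using s_int by simp
    assume "0 \<le> c"
    then have "(\<integral>t. support_fun (c *\<^sub>R y) (\<Gamma> t) \<partial>m) = (\<integral>t. c * support_fun y (\<Gamma> t) \<partial>m)"
      by (intro Bochner_Integration.integral_cong refl support_fun_scaleR cwk)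
    then show "(\<integral>t. support_fun (c *\<^sub>R y) (\<Gamma> t) \<partial>m) = c * (\<integral>t. support_fun y (\<Gamma> t) \<partial>m)"
      by simp
  qed
  show "\<exists>x. \<forall>y. L y = blinfun_apply y x"
    if "linear L" "\<And>y. L y \<le> (\<integral>t. support_fun y (\<Gamma> t) \<partial>m)" for L
    by (rule functional_below_limit_is_evaluation[OF m \<Gamma> si uac C lim that])
qed

text \<open>
  A set that is small for \<open>m\<close> is uniformly small for all \<open>mn n\<close>, so the integrals over it at stage \<open>n\<close>
  are uniformly small, and so is their limit. Splitting the set by the sign of the integrand passes
  from the modulus of the integral to the integral of the modulus.
\<close>
lemma limit_has_ac_integral:
  fixes \<Gamma> :: "'w \<Rightarrow> 'x::real_normed_vector set"
  assumes m: "finite_measure m" and sets: "\<And>n. sets (mn n) = sets m"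
    and j: "scalarly_uniformly_ac_integrals mn \<Gamma>n"
    and jj: "scalarly_integrable m \<Gamma>"
    and jjj: "uniformly_absolutely_continuous mn m"
    and v: "\<And>A f. A \<in> sets m \<Longrightarrow>
      (\<lambda>n. LINT t:A|mn n. support_fun f (\<Gamma>n n t)) \<longlonglongrightarrow> (LINT t:A|m. support_fun f (\<Gamma> t))"
  shows "scalarly_ac_integral m \<Gamma>"
  unfolding scalarly_ac_integral_def
proof (intro allI impI)
  fix \<epsilon> :: real assume \<epsilon>: "0 < \<epsilon>"
  interpret finite_measure m by fact
  have si: "scalarly_integrable (mn n) (\<Gamma>n n)" for n
    using j by (simp add: scalarly_uniformly_ac_integrals_def)
  have s_int: "integrable m (\<lambda>t. support_fun y (\<Gamma> t))" for y
    using jj by (simp add: scalarly_integrable_def)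
  obtain \<delta>1 :: real where \<delta>1: "\<delta>1 > 0" and small1: "\<And>n A. A \<in> sets (mn n) \<Longrightarrow> emeasure (mn n) A < ennreal \<delta>1 \<Longrightarrow>
      (SUP f\<in>{f. norm f \<le> 1}. ennreal (LINT t:A|mn n. \<bar>support_fun f (\<Gamma>n n t)\<bar>)) < ennreal (\<epsilon> / 2)"
    using j \<epsilon> unfolding scalarly_uniformly_ac_integrals_def by (meson half_gt_zero)
  obtain \<delta> :: real where \<delta>: "\<delta> > 0" and small: "\<And>E. E \<in> sets m \<Longrightarrow> emeasure m E < ennreal \<delta> \<Longrightarrow>
      (SUP n. emeasure (mn n) E) < ennreal \<delta>1"
    using jjj \<delta>1 unfolding uniformly_absolutely_continuous_def by meson
  have bound: "\<bar>LINT t:E|m. support_fun y (\<Gamma> t)\<bar> \<le> \<epsilon> / 2"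
    if y: "norm y \<le> 1" and E: "E \<in> sets m" "measure m E < \<delta>" for y E
  proof (rule LIMSEQ_le_const2[OF tendsto_rabs[OF v[OF E(1)]]])
    have "emeasure m E < ennreal \<delta>"
      using E(2) by (simp add: emeasure_eq_measure ennreal_less_iff)
    from small[OF E(1) this] have lt: "emeasure (mn n) E < ennreal \<delta>1" for n
      by (rule le_less_trans[OF SUP_upper[OF UNIV_I]])
    have "\<bar>LINT t:E|mn n. support_fun y (\<Gamma>n n t)\<bar> \<le> \<epsilon> / 2" for n
    proof -
      have En: "E \<in> sets (mn n)" using E sets by simp
      have "integrable (mn n) (\<lambda>t. support_fun y (\<Gamma>n n t))"
        using si by (simp add: scalarly_integrable_def)
      then have "norm (LINT t:E|mn n. support_fun y (\<Gamma>n n t)) \<le> (LINT t:E|mn n. norm (support_fun y (\<Gamma>n n t)))"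
        using En by (intro set_integral_norm_bound) (simp only: set_integrable_def integrable_mult_indicator)
      moreover have "ennreal (LINT t:E|mn n. \<bar>support_fun y (\<Gamma>n n t)\<bar>) < ennreal (\<epsilon> / 2)"
        by (rule le_less_trans[OF SUP_upper small1[OF En lt]]) (use y in simp)
      then have "(LINT t:E|mn n. \<bar>support_fun y (\<Gamma>n n t)\<bar>) < \<epsilon> / 2"
        using \<epsilon> by (simp add: ennreal_less_iff set_lebesgue_integral_def integral_nonneg_AE)
      ultimately show ?thesis by simp
    qed
    then show "\<exists>N. \<forall>n\<ge>N. \<bar>LINT t:E|mn n. support_fun y (\<Gamma>n n t)\<bar> \<le> \<epsilon> / 2" by blast
  qed
  have "(LINT t:E|m. \<bar>support_fun y (\<Gamma> t)\<bar>) \<le> \<epsilon>"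
    if y: "norm y \<le> 1" and E: "E \<in> sets m" "measure m E < \<delta>" for y E
  proof -
    let ?s = "\<lambda>t. support_fun y (\<Gamma> t)"
    have [measurable]: "?s \<in> borel_measurable m" using s_int by auto
    define P where "P = E \<inter> {t \<in> space m. 0 \<le> ?s t}"
    define Q where "Q = E - P"
    have PQ: "P \<in> sets m" "Q \<in> sets m"
      using E(1) unfolding P_def Q_def by auto
    have "measure m P < \<delta>" "measure m Q < \<delta>"
      using E PQ finite_measure_mono[of P E] finite_measure_mono[of Q E]
      by (auto simp: P_def Q_def)
    note PQ_bound = bound[OF y PQ(1) this(1)] bound[OF y PQ(2) this(2)]
    have "(LINT t:E|m. \<bar>?s t\<bar>) = (\<integral>t. indicator P t *\<^sub>R ?s t - indicator Q t *\<^sub>R ?s t \<partial>m)"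
      unfolding set_lebesgue_integral_def
      by (intro Bochner_Integration.integral_cong refl) (auto simp: P_def Q_def indicator_def)
    also have "\<dots> = (LINT t:P|m. ?s t) - (LINT t:Q|m. ?s t)"
      using integrable_mult_indicator[OF PQ(1) s_int] integrable_mult_indicator[OF PQ(2) s_int]
      by (simp add: set_lebesgue_integral_def)
    finally show ?thesis using PQ_bound by linarith
  qed
  with \<delta> show "\<exists>\<delta>>0. \<forall>y E. norm y \<le> 1 \<longrightarrow> E \<in> sets m \<longrightarrow> measure m E < \<delta> \<longrightarrow>
      (LINT t:E|m. \<bar>support_fun y (\<Gamma> t)\<bar>) \<le> \<epsilon>"
    by blast
qed

theorem proposition4p4:
  fixes \<Omega> :: "'w set" and \<A> :: "'w set set"
    and \<Gamma> :: "'w \<Rightarrow> 'x::banach set" and \<Gamma>n :: "nat \<Rightarrow> 'w \<Rightarrow> 'x set"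
    and m :: "'w measure" and mn :: "nat \<Rightarrow> 'w measure"
  assumes "sigma_algebra \<Omega> \<A>"
    and "finite_measure m" and "space m = \<Omega>" and "sets m = \<A>"
    and "\<And>n. finite_measure (mn n)" and "\<And>n. space (mn n) = \<Omega>" and "\<And>n. sets (mn n) = \<A>"
    and "\<Gamma> \<in> \<Omega> \<rightarrow> cwk" and "\<And>n. \<Gamma>n n \<in> \<Omega> \<rightarrow> cwk"
    and "scalarly_measurable (sigma \<Omega> \<A>) \<Gamma>"
    and "\<And>n. scalarly_measurable (sigma \<Omega> \<A>) (\<Gamma>n n)"
    and j: "scalarly_uniformly_ac_integrals mn \<Gamma>n"
    and jj: "scalarly_integrable m \<Gamma>"
    and jjj: "uniformly_absolutely_continuous mn m"
    and jv: "\<And>n. pettis_integrable_cwk (mn n) (\<Gamma>n n)"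
    and v: "\<And>A f. A \<in> \<A> \<Longrightarrow>
      (\<lambda>n. LINT t:A|mn n. support_fun f (\<Gamma>n n t)) \<longlonglongrightarrow> (LINT t:A|m. support_fun f (\<Gamma> t))"
  shows "pettis_integrable_cwk m \<Gamma>"
  unfolding pettis_integrable_cwk_def
proof (intro conjI ballI jj)
  fix A assume A: "A \<in> sets m"
  have m: "finite_measure m" by fact
  have sets: "sets (mn n) = sets m" for n
    using assms(4,7) by simp
  have v': "(\<lambda>n. LINT t:B|mn n. support_fun f (\<Gamma>n n t)) \<longlonglongrightarrow> (LINT t:B|m. support_fun f (\<Gamma> t))"
    if "B \<in> sets m" for B f
    using that assms(4) by (intro v) simp
  have s_int: "integrable m (\<lambda>t. support_fun y (\<Gamma> t))" for y
    using jj by (simp add: scalarly_integrable_def)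
  \<comment> \<open>Replacing \<open>\<Gamma>\<close> by the set \<open>{0}\<close>, whose support function vanishes, turns integrals over \<open>A\<close> into
    integrals over the whole space.\<close>
  define \<Gamma>A where "\<Gamma>A t = (if t \<in> A then \<Gamma> t else {0})" for t
  have s_\<Gamma>A: "support_fun y (\<Gamma>A t) = indicator A t *\<^sub>R support_fun y (\<Gamma> t)" for y t
    by (simp add: \<Gamma>A_def support_fun_def indicator_def)
  have integral_\<Gamma>A: "(\<integral>t. support_fun y (\<Gamma>A t) \<partial>m) = (LINT t:A|m. support_fun y (\<Gamma> t))" for y
    by (simp add: s_\<Gamma>A set_lebesgue_integral_def)
  have "\<exists>C\<in>cwk. \<forall>f. support_fun f C = (LINT t:A|mn n. support_fun f (\<Gamma>n n t))" for n
    using jv[of n] A sets unfolding pettis_integrable_cwk_def by simp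
  then obtain C where C: "\<And>n. C n \<in> cwk"
    and s_C: "\<And>n f. support_fun f (C n) = (LINT t:A|mn n. support_fun f (\<Gamma>n n t))"
    by metis
  have "\<exists>K\<in>cwk. \<forall>y. support_fun y K = (\<integral>t. support_fun y (\<Gamma>A t) \<partial>m)"
  proof (rule limit_of_support_funs_is_support_fun[OF m _ _ _ C])
    show "\<Gamma>A \<in> space m \<rightarrow> cwk"
      using assms(3,8) cwk_singleton_0 by (auto simp: \<Gamma>A_def)
    show "scalarly_integrable m \<Gamma>A"
      unfolding scalarly_integrable_def s_\<Gamma>A using integrable_mult_indicator[OF A s_int] by blast
    show "(\<lambda>n. support_fun y (C n)) \<longlonglongrightarrow> (\<integral>t. support_fun y (\<Gamma>A t) \<partial>m)" for y
      unfolding s_C integral_\<Gamma>A by (rule v'[OF A])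
    show "scalarly_ac_integral m \<Gamma>A"
      unfolding scalarly_ac_integral_def
    proof (intro allI impI)
      fix \<epsilon> :: real assume "0 < \<epsilon>"
      then obtain \<delta> where \<delta>: "\<delta> > 0" and small: "\<And>y E. norm y \<le> 1 \<Longrightarrow> E \<in> sets m \<Longrightarrow> measure m E < \<delta> \<Longrightarrow>
          (LINT t:E|m. \<bar>support_fun y (\<Gamma> t)\<bar>) \<le> \<epsilon>"
        using limit_has_ac_integral[OF m sets j jj jjj v'] unfolding scalarly_ac_integral_def by blast
      have "(LINT t:E|m. \<bar>support_fun y (\<Gamma>A t)\<bar>) \<le> \<epsilon>"
        if "norm y \<le> 1" and E: "E \<in> sets m" "measure m E < \<delta>" for y E
      proof -
        have "(LINT t:E|m. \<bar>support_fun y (\<Gamma>A t)\<bar>) \<le> (LINT t:E|m. \<bar>support_fun y (\<Gamma> t)\<bar>)"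
          unfolding set_lebesgue_integral_def s_\<Gamma>A using E A s_int
          by (intro integral_mono integrable_mult_indicator integrable_abs)
            (simp_all add: indicator_def del: real_scaleR_def)
        also have "\<dots> \<le> \<epsilon>" using that by (rule small)
        finally show ?thesis .
      qed
      with \<delta> show "\<exists>\<delta>>0. \<forall>y E. norm y \<le> 1 \<longrightarrow> E \<in> sets m \<longrightarrow> measure m E < \<delta> \<longrightarrow>
          (LINT t:E|m. \<bar>support_fun y (\<Gamma>A t)\<bar>) \<le> \<epsilon>"
        by blast
    qed
  qed
  then show "\<exists>C\<in>cwk. \<forall>f. support_fun f C = (LINT t:A|m. support_fun f (\<Gamma> t))"
    by (simp add: integral_\<Gamma>A)
qed

end
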